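(* Let $\xi$ be the Rosenblatt process with parameter $H\in(\frac12,1)$. For any $0\le s<t$ there exists a neighborhood $U(s,t)$ of $0$ in $\mathbb R^2$ such that $$D^\xi_\tau(z_1,z_2,s,t)=\Big|\log Ee^{i(z_1(\xi_t-\xi_s)+z_2(\xi_{t+\tau}-\xi_{s+\tau}))}-\log Ee^{iz_1(\xi_t-\xi_s)}-\log Ee^{iz_2(\xi_{t+\tau}-\xi_{s+\tau})}\Big|$$ is well defined for all $(z_1,z_2)\in U(s,t)$ and all $\tau>0$, and, with these neighborhoods, the number $$\kappa=\inf_{0\le s<t}\ \inf_{(z_1,z_2)\in U(s,t)}\ \sup\{\gamma>0:\ D^\xi_\tau(z_1,z_2,s,t)=o(\tau^{-\gamma})\ \text{as}\ \tau\to\infty\}$$ satisfies $\kappa=2-2H$.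
   Context: Rosenblatt process with parameter $H\in(\frac12,1)$: the real process $\xi=(\xi_t)_{t\ge0}$ whose finite-dimensional distributions are determined by $$E\exp\Big\{i\sum_{j=1}^p\theta_j\xi_{t_j}\Big\}=\exp\Big\{\frac12\sum_{k=2}^\infty\frac{(2i\sigma)^k}{k}R_{H,k}(\theta_1,\dots,\theta_p;t_1,\dots,t_p)\Big\}$$ for $(\theta_1,\dots,\theta_p)$ in a small neighborhood of $0$ (depending on $t_1,\dots,t_p$), where $\sigma=[\frac12H(2H-1)]^{1/2}$, $$R_{H,k}=\int_{\mathbb R^k}\psi(x_1)\cdots\psi(x_k)|x_1-x_2|^{H-1}|x_2-x_3|^{H-1}\cdots|x_{k-1}-x_k|^{H-1}|x_k-x_1|^{H-1}dx_1\cdots dx_k,$$ and $\psi=\sum_{j=1}^p\theta_j\mathbf 1_{[0,t_j]}$. The logarithm is the branch that is continuous in $(z_1,z_2)$ and vanishes at $(z_1,z_2)=(0,0)$. *)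

theory Defs
  imports "HOL-Probability.Probability" "HOL-Library.Landau_Symbols"
begin

definition step_fun :: "nat \<Rightarrow> (nat \<Rightarrow> real) \<Rightarrow> (nat \<Rightarrow> real) \<Rightarrow> real \<Rightarrow> real" where
  "step_fun p \<theta> t x = (\<Sum>j<p. \<theta> j * indicator {0..t j} x)"

text \<open>
  Indices are shifted to start at 0, so the cyclic product runs over \<open>i < k\<close> with the successor
  of \<open>i\<close> taken modulo \<open>k\<close>. On the null set where two neighbouring coordinates coincide the
  kernel takes the value \<open>0 powr (H - 1) = 0\<close> instead of infinity; this does not affect
  the integral.
\<close>
definition rosenblatt_R ::
    "real \<Rightarrow> nat \<Rightarrow> nat \<Rightarrow> (nat \<Rightarrow> real) \<Rightarrow> (nat \<Rightarrow> real) \<Rightarrow> real" where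
  "rosenblatt_R H k p \<theta> t =
     (\<integral>x. (\<Prod>i<k. step_fun p \<theta> t (x i)) * (\<Prod>i<k. \<bar>x i - x ((i + 1) mod k)\<bar> powr (H - 1))
        \<partial>(\<Pi>\<^sub>M i\<in>{..<k}. lborel))"

definition rosenblatt_sigma :: "real \<Rightarrow> real" where
  "rosenblatt_sigma H = sqrt (H * (2 * H - 1) / 2)"

definition rosenblatt_term ::
    "real \<Rightarrow> nat \<Rightarrow> (nat \<Rightarrow> real) \<Rightarrow> (nat \<Rightarrow> real) \<Rightarrow> nat \<Rightarrow> complex" where
  "rosenblatt_term H p \<theta> t k =
     (2 * \<i> * of_real (rosenblatt_sigma H)) ^ k / of_nat k * of_real (rosenblatt_R H k p \<theta> t)"

text \<open>
  Only the values \<open>\<xi> t\<close> with \<open>t \<ge> 0\<close> are constrained. The radius \<open>\<epsilon>\<close> may depend on the times.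
  The series starts at \<open>k = 2\<close>.
\<close>
definition rosenblatt_process :: "real \<Rightarrow> 'a measure \<Rightarrow> (real \<Rightarrow> 'a \<Rightarrow> real) \<Rightarrow> bool" where
  "rosenblatt_process H M \<xi> \<longleftrightarrow>
     prob_space M \<and>
     (\<forall>t\<ge>0. \<xi> t \<in> borel_measurable M) \<and>
     (\<forall>p t. (\<forall>j<p. 0 \<le> t j) \<longrightarrow>
        (\<exists>\<epsilon>>0. \<forall>\<theta>. (\<forall>j<p. \<bar>\<theta> j\<bar> < \<epsilon>) \<longrightarrow>
           summable (\<lambda>k. rosenblatt_term H p \<theta> t (k + 2)) \<and>
           prob_space.expectation M (\<lambda>\<omega>. exp (\<i> * of_real (\<Sum>j<p. \<theta> j * \<xi> (t j) \<omega>)))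
             = exp (1 / 2 * (\<Sum>k. rosenblatt_term H p \<theta> t (k + 2)))))"

definition log_branch_on ::
    "(real \<times> real) set \<Rightarrow> (real \<times> real \<Rightarrow> complex) \<Rightarrow> (real \<times> real \<Rightarrow> complex) \<Rightarrow> bool" where
  "log_branch_on U f L \<longleftrightarrow>
     continuous_on U L \<and> (\<forall>z\<in>U. exp (L z) = f z) \<and> L (0, 0) = 0"

definition log_well_defined_on ::
    "(real \<times> real) set \<Rightarrow> (real \<times> real \<Rightarrow> complex) \<Rightarrow> bool" where
  "log_well_defined_on U f \<longleftrightarrow>
     (\<exists>L. log_branch_on U f L) \<and>
     (\<forall>L L'. log_branch_on U f L \<and> log_branch_on U f L' \<longrightarrow> (\<forall>z\<in>U. L z = L' z))"

definition log_on ::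
    "(real \<times> real) set \<Rightarrow> (real \<times> real \<Rightarrow> complex) \<Rightarrow> real \<times> real \<Rightarrow> complex" where
  "log_on U f z = (THE w. \<exists>L. log_branch_on U f L \<and> L z = w)"

definition cf_joint ::
    "'a measure \<Rightarrow> (real \<Rightarrow> 'a \<Rightarrow> real) \<Rightarrow> real \<Rightarrow> real \<Rightarrow> real \<Rightarrow> real \<times> real \<Rightarrow> complex" where
  "cf_joint M \<xi> s t \<tau> = (\<lambda>(z1, z2). prob_space.expectation M
     (\<lambda>\<omega>. exp (\<i> * of_real (z1 * (\<xi> t \<omega> - \<xi> s \<omega>) + z2 * (\<xi> (t + \<tau>) \<omega> - \<xi> (s + \<tau>) \<omega>)))))"

definition cf_fst ::
    "'a measure \<Rightarrow> (real \<Rightarrow> 'a \<Rightarrow> real) \<Rightarrow> real \<Rightarrow> real \<Rightarrow> real \<times> real \<Rightarrow> complex" where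
  "cf_fst M \<xi> s t = (\<lambda>(z1, z2). prob_space.expectation M
     (\<lambda>\<omega>. exp (\<i> * of_real (z1 * (\<xi> t \<omega> - \<xi> s \<omega>)))))"

definition cf_snd ::
    "'a measure \<Rightarrow> (real \<Rightarrow> 'a \<Rightarrow> real) \<Rightarrow> real \<Rightarrow> real \<Rightarrow> real \<Rightarrow> real \<times> real \<Rightarrow> complex" where
  "cf_snd M \<xi> s t \<tau> = (\<lambda>(z1, z2). prob_space.expectation M
     (\<lambda>\<omega>. exp (\<i> * of_real (z2 * (\<xi> (t + \<tau>) \<omega> - \<xi> (s + \<tau>) \<omega>)))))"

definition D_well_defined_on ::
    "(real \<times> real) set \<Rightarrow> 'a measure \<Rightarrow> (real \<Rightarrow> 'a \<Rightarrow> real) \<Rightarrow> real \<Rightarrow> real \<Rightarrow> real \<Rightarrow> bool" where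
  "D_well_defined_on U M \<xi> s t \<tau> \<longleftrightarrow>
     log_well_defined_on U (cf_joint M \<xi> s t \<tau>) \<and>
     log_well_defined_on U (cf_fst M \<xi> s t) \<and>
     log_well_defined_on U (cf_snd M \<xi> s t \<tau>)"

definition D_xi ::
    "(real \<times> real) set \<Rightarrow> 'a measure \<Rightarrow> (real \<Rightarrow> 'a \<Rightarrow> real) \<Rightarrow> real \<Rightarrow> real \<times> real \<Rightarrow> real \<Rightarrow> real \<Rightarrow> real"
  where
  "D_xi U M \<xi> \<tau> z s t =
     cmod (log_on U (cf_joint M \<xi> s t \<tau>) z - log_on U (cf_fst M \<xi> s t) z
           - log_on U (cf_snd M \<xi> s t \<tau>) z)"

text \<open>
  Extended real valued: where \<open>D_xi\<close> vanishes identically, e.g. for \<open>z1 = 0\<close>, the inner supremum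
  is infinite.
\<close>
definition decay_exponent ::
    "(real \<Rightarrow> real \<Rightarrow> (real \<times> real) set) \<Rightarrow> 'a measure \<Rightarrow> (real \<Rightarrow> 'a \<Rightarrow> real) \<Rightarrow> ereal" where
  "decay_exponent U M \<xi> =
     (INF (s, t)\<in>{(s, t). 0 \<le> s \<and> s < t}. INF z\<in>U s t.
        SUP \<gamma>\<in>{\<gamma>. \<gamma> > 0 \<and> (\<lambda>\<tau>. D_xi (U s t) M \<xi> \<tau> z s t) \<in> o[at_top](\<lambda>\<tau>. \<tau> powr (- \<gamma>))}. ereal \<gamma>)"

end

theory Submission
  imports Defs "HOL-Complex_Analysis.Complex_Analysis"
begin

text \<open>
  Let \<open>X\<close> and \<open>Y\<close> be the increments of the process over \<open>A = (s, t]\<close> and \<open>B = (s + \<tau>, t + \<tau>]\<close>. Near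
  the origin the logarithm of the joint characteristic function at \<open>(z1, z2)\<close> is the cumulant series
  \<open>1/2 \<Sum>k (2 \<i> \<sigma>)^k / k * R_k(f)\<close> of the step function \<open>f = z1 1_A + z2 1_B\<close>, where \<open>R_k(f)\<close>
  integrates \<open>f (x_1) ... f (x_k)\<close> against the kernel \<open>\<bar>x - y\<bar>^(H-1)\<close> over the edges of the cycle
  \<open>x_1, ..., x_k, x_1\<close>. Subtracting the two marginal logarithms removes exactly the configurations
  whose points all lie in \<open>A\<close> or all lie in \<open>B\<close>, so that \<open>D\<close> is the modulus of the series of the
  remaining, mixed, configurations.

  Upper bound. Around a mixed configuration the cycle goes from \<open>A\<close> to \<open>B\<close> and back, so at least two
  of its edges are longer than \<open>\<tau> - (t - s)\<close>; together they contribute at most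
  \<open>(\<tau> - (t - s))^(2H-2)\<close>. The graph that is left when they are deleted has no cycle, and its integral can be
  computed vertex by vertex and is at most \<open>C^k\<close> with \<open>C\<close> independent of \<open>\<tau>\<close>
  (\<open>cycle_without_edge_integral_le\<close>, \<open>mixed_cycle_integrand_le\<close>, \<open>abs_mixed_cycle_le\<close>). Hence
  \<open>D = O(\<tau>^(2H-2))\<close> for all small \<open>(z1, z2)\<close>, and every positive \<open>\<gamma> < 2 - 2H\<close> is a decay rate.

  Lower bound. For \<open>z1 = z2 = v\<close> the mixed part of \<open>R_2\<close> is at least
  \<open>2 v^2 (t - s)^2 (\<tau> + (t - s))^(2H-2)\<close> (\<open>mixed_cycle_2_ge\<close>), whereas the terms with \<open>k \<ge> 3\<close> are at most of
  order \<open>v^3 \<tau>^(2H-2)\<close>. If \<open>v\<close> is small, \<open>D\<close> is therefore of exact order \<open>\<tau>^(2H-2)\<close> (\<open>D_xi_ge\<close>), and no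
  \<open>\<gamma> > 2 - 2H\<close> is a decay rate.

  A neighborhood that works for all \<open>\<tau>\<close>. The process is described by its cumulant series only in a
  neighborhood of \<open>0\<close> that may shrink as \<open>\<tau>\<close> grows, although the series itself converges in a box that
  depends on \<open>t - s\<close> alone. The gap is closed by a general fact (\<open>char_eq_holomorphic_extension\<close>): a
  characteristic function that agrees near \<open>0\<close> with a function holomorphic in a disc agrees with it on
  the whole diameter. Along every ray in the box the characteristic function is thus the exponential
  of the series, in particular it does not vanish, and the branch of the logarithm is the series
  (\<open>log_on_eq_radial_lift\<close>).
\<close>

section \<open>Integrals of kernels along a path and along a cycle with one edge removed\<close>

text \<open>
  Where \<open>\<bar>y - x\<bar> \<le> 1\<close> the singularity is integrable and contributes at most \<open>2 / (b + 1)\<close>; elsewhere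
  the kernel is at most \<open>1\<close>. The bound depends neither on \<open>y\<close> nor on the position of \<open>W\<close>.
\<close>
lemma nn_integral_powr_kernel_le:
  fixes b y w :: real
  assumes b: "-1 < b" "b \<le> 0" and [measurable]: "W \<in> sets borel"
    and w: "emeasure lborel W \<le> ennreal w" "0 \<le> w"
  shows "(\<integral>\<^sup>+x. ennreal (\<bar>y - x\<bar> powr b) * indicator W x \<partial>lborel) \<le> ennreal (2 / (b + 1) + w)"
proof -
  define f where "f u = ennreal (u powr b) * indicator {0..1} u" for u :: real
  have [measurable]: "f \<in> borel_measurable borel"
    unfolding f_def by measurable
  have "((\<lambda>x. x powr b) has_integral (1 powr (b+1) / (b+1))) {0..1}"
    using b by (intro has_integral_powr_from_0) auto
  then have If: "(\<integral>\<^sup>+u. f u \<partial>lborel) = ennreal (1 / (b + 1))"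
    unfolding f_def
    by (subst nn_integral_has_integral_lebesgue') auto
  have pw: "ennreal (\<bar>y - x\<bar> powr b) * indicator W x \<le> (f (x - y) + f (y - x)) + indicator W x" for x
  proof (cases "\<bar>y - x\<bar> \<le> 1")
    case True
    then have "ennreal (\<bar>y - x\<bar> powr b) \<le> f (x - y) + f (y - x)"
      by (cases "x \<le> y") (auto simp: f_def indicator_def abs_minus_commute)
    then show ?thesis
      by (auto simp: indicator_def intro: order_trans)
  next
    case False
    then have "\<bar>y - x\<bar> powr b \<le> 1"
      using b powr_mono2'[of b 1 "\<bar>y - x\<bar>"] by simp
    then show ?thesis
      by (auto simp: indicator_def intro!: add_increasing)
  qed
  have "(\<integral>\<^sup>+x. ennreal (\<bar>y - x\<bar> powr b) * indicator W x \<partial>lborel)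
      \<le> (\<integral>\<^sup>+x. (f (x - y) + f (y - x)) + indicator W x \<partial>lborel)"
    by (intro nn_integral_mono pw)
  also have "\<dots> = (\<integral>\<^sup>+x. f (x - y) \<partial>lborel) + (\<integral>\<^sup>+x. f (y - x) \<partial>lborel) + emeasure lborel W"
    by (simp add: nn_integral_add)
  also have "(\<integral>\<^sup>+x. f (x - y) \<partial>lborel) = (\<integral>\<^sup>+u. f u \<partial>lborel)"
    using nn_integral_real_affine[of f 1 "-y"] by simp
  also have "(\<integral>\<^sup>+x. f (y - x) \<partial>lborel) = (\<integral>\<^sup>+u. f u \<partial>lborel)"
    using nn_integral_real_affine[of f "-1" y] by simp
  also have "(\<integral>\<^sup>+u. f u \<partial>lborel) + (\<integral>\<^sup>+u. f u \<partial>lborel) + emeasure lborel W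
      \<le> ennreal (1 / (b + 1)) + ennreal (1 / (b + 1)) + ennreal w"
    unfolding If using w by (intro add_mono) auto
  also have "\<dots> = ennreal (2 / (b + 1) + w)"
    using b w by (simp add: ennreal_plus[symmetric] field_simps del: ennreal_plus)
  finally show ?thesis .
qed

lemma kernel_component_measurable:
  fixes g :: "real \<Rightarrow> real \<Rightarrow> 'b::topological_space"
  assumes "case_prod g \<in> borel_measurable (borel \<Otimes>\<^sub>M borel)" "i \<in> I" "j \<in> I"
  shows "(\<lambda>x. g (x i) (x j)) \<in> borel_measurable (\<Pi>\<^sub>M i\<in>I. lborel)"
proof -
  have "(\<lambda>x. (x i, x j)) \<in> (\<Pi>\<^sub>M i\<in>I. lborel) \<rightarrow>\<^sub>M lborel \<Otimes>\<^sub>M (lborel :: real measure)"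
    using assms(2,3) by (intro measurable_Pair measurable_component_singleton)
  moreover have "sets (lborel \<Otimes>\<^sub>M lborel) = sets (borel \<Otimes>\<^sub>M (borel :: real measure))"
    by (intro sets_pair_measure_cong) simp_all
  ultimately have "(\<lambda>x. (x i, x j)) \<in> (\<Pi>\<^sub>M i\<in>I. lborel) \<rightarrow>\<^sub>M borel \<Otimes>\<^sub>M (borel :: real measure)"
    using measurable_cong_sets[OF refl] by blast
  from measurable_compose[OF this assms(1)] show ?thesis by simp
qed

text \<open>
  Integrating out the last vertex of the path leaves the same integral over the shorter path, and
  costs a factor \<open>C\<close> because only one edge ends there. The map \<open>v\<close> lists the coordinates in the order in
  which the path visits them; this freedom is needed to start the path anywhere on a cycle.
\<close>
lemma path_integral_le:
  fixes g :: "nat \<Rightarrow> real \<Rightarrow> real \<Rightarrow> ennreal" and v :: "nat \<Rightarrow> nat"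
  assumes inj: "inj_on v {..n}" and W[measurable]: "W \<in> sets borel"
    and g[measurable]: "\<And>i. case_prod (g i) \<in> borel_measurable (borel \<Otimes>\<^sub>M borel)"
    and C: "\<And>i x. (\<integral>\<^sup>+y. g i x y * indicator W y \<partial>lborel) \<le> C"
  shows "(\<integral>\<^sup>+x. (\<Prod>j\<le>n. indicator W (x (v j))) * (\<Prod>j<n. g (v j) (x (v j)) (x (v (Suc j))))
      \<partial>(\<Pi>\<^sub>M i\<in>v ` {..n}. lborel)) \<le> emeasure lborel W * C ^ n"
  using inj
proof (induction n)
  case 0
  interpret product_sigma_finite "\<lambda>_::nat. lborel :: real measure" ..
  have "(\<integral>\<^sup>+x. indicator W (x (v 0)) \<partial>(\<Pi>\<^sub>M i\<in>{v 0}. lborel)) = emeasure lborel W"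
    using product_nn_integral_singleton[of "indicator W" "v 0"] by simp
  then show ?case by simp
next
  case (Suc n)
  interpret product_sigma_finite "\<lambda>_::nat. lborel :: real measure" ..
  define F where "F x = (\<Prod>j\<le>n. indicator W (x (v j))) * (\<Prod>j<n. g (v j) (x (v j)) (x (v (Suc j))))"
    for x :: "nat \<Rightarrow> real"
  have new: "v (Suc n) \<notin> v ` {..n}"
    using Suc.prems by (fastforce simp: inj_on_def)
  have m1: "(\<lambda>x. g (v j) (x (v j)) (x (v (Suc j)))) \<in> borel_measurable (\<Pi>\<^sub>M i\<in>v ` {..m}. lborel)"
    if "Suc j \<le> m" for j m
    using that by (intro kernel_component_measurable g) auto
  have m2: "(\<lambda>x. indicator W (x (v j)) :: ennreal) \<in> borel_measurable (\<Pi>\<^sub>M i\<in>v ` {..m}. lborel)"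
    if "j \<le> m" for j m
    using that kernel_component_measurable[of "\<lambda>y _. indicator W y" "v j" "v ` {..m}" "v j"] by simp
  have Fm: "F \<in> borel_measurable (\<Pi>\<^sub>M i\<in>v ` {..n}. lborel)"
    unfolding F_def by (intro borel_measurable_times_ennreal borel_measurable_prod_ennreal m1 m2) auto
  have Sm: "(\<lambda>x. (\<Prod>j\<le>Suc n. indicator W (x (v j))) * (\<Prod>j<Suc n. g (v j) (x (v j)) (x (v (Suc j)))))
       \<in> borel_measurable (\<Pi>\<^sub>M i\<in>v ` {..Suc n}. lborel)"
    by (intro borel_measurable_times_ennreal borel_measurable_prod_ennreal m1 m2) auto
  have upd: "(x(v (Suc n) := y)) (v j) = x (v j)" if "j \<le> n" for x y j
  proof -
    have "v j \<noteq> v (Suc n)" using new that by (metis atMost_iff imageI)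
    then show ?thesis by simp
  qed
  define G where "G x = (\<Prod>j\<le>Suc n. indicator W (x (v j))) * (\<Prod>j<Suc n. g (v j) (x (v j)) (x (v (Suc j))))"
    for x :: "nat \<Rightarrow> real"
  have GF: "G (x(v (Suc n) := y)) = F x * (g (v n) (x (v n)) y * indicator W y)" for x y
  proof -
    have "(\<Prod>j\<le>n. indicator W ((x(v (Suc n) := y)) (v j))) = (\<Prod>j\<le>n. indicator W (x (v j)) :: ennreal)"
      by (intro prod.cong refl) (simp add: upd del: fun_upd_apply)
    moreover have "(\<Prod>j<n. g (v j) ((x(v (Suc n) := y)) (v j)) ((x(v (Suc n) := y)) (v (Suc j))))
        = (\<Prod>j<n. g (v j) (x (v j)) (x (v (Suc j))))"
      by (intro prod.cong refl) (simp add: upd del: fun_upd_apply)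
    ultimately show ?thesis
      unfolding G_def F_def prod.atMost_Suc prod.lessThan_Suc upd[OF le_refl]
      by (simp only: fun_upd_same mult_ac)
  qed
  have vS: "v ` {..Suc n} = insert (v (Suc n)) (v ` {..n})"
    by (simp add: atMost_Suc)
  have "(\<integral>\<^sup>+x. G x \<partial>(\<Pi>\<^sub>M i\<in>v ` {..Suc n}. lborel))
    = (\<integral>\<^sup>+x. (\<integral>\<^sup>+y. G (x(v (Suc n) := y)) \<partial>lborel) \<partial>(\<Pi>\<^sub>M i\<in>v ` {..n}. lborel))"
    using Sm unfolding vS G_def[symmetric] by (intro product_nn_integral_insert new) auto
  also have "\<dots> = (\<integral>\<^sup>+x. (\<integral>\<^sup>+y. (F x * (g (v n) (x (v n)) y * indicator W y)) \<partial>lborel) \<partial>(\<Pi>\<^sub>M i\<in>v ` {..n}. lborel))"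
    unfolding GF ..
  also have "\<dots> \<le> (\<integral>\<^sup>+x. F x * C \<partial>(\<Pi>\<^sub>M i\<in>v ` {..n}. lborel))"
  proof (intro nn_integral_mono)
    fix x
    have "(\<integral>\<^sup>+y. (F x * (g (v n) (x (v n)) y * indicator W y)) \<partial>lborel)
       = F x * (\<integral>\<^sup>+y. (g (v n) (x (v n)) y * indicator W y) \<partial>lborel)"
    proof (rule nn_integral_cmult)
      have "(\<lambda>y. (x (v n), y)) \<in> borel \<rightarrow>\<^sub>M borel \<Otimes>\<^sub>M (borel :: real measure)" by measurable
      from measurable_compose[OF this g[of "v n"]]
      show "(\<lambda>y. g (v n) (x (v n)) y * indicator W y) \<in> borel_measurable lborel" by simp
    qed
    also have "\<dots> \<le> F x * C"
      by (intro mult_left_mono C) auto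
    finally show "(\<integral>\<^sup>+y. (F x * (g (v n) (x (v n)) y * indicator W y)) \<partial>lborel) \<le> F x * C" .
  qed
  also have "\<dots> = (\<integral>\<^sup>+x. F x \<partial>(\<Pi>\<^sub>M i\<in>v ` {..n}. lborel)) * C"
    by (intro nn_integral_multc Fm)
  also have "\<dots> \<le> emeasure lborel W * C ^ n * C"
    unfolding F_def by (intro mult_right_mono Suc.IH inj_on_subset[OF Suc.prems]) auto
  finally show ?case unfolding G_def by (simp only: power_Suc mult_ac)
qed

lemma rotate_bij_betw:
  fixes e k :: nat
  assumes "e < k"
  shows "bij_betw (\<lambda>j. (e + 1 + j) mod k) {..<k} {..<k}"
proof -
  have "inj_on (\<lambda>j. (e + 1 + j) mod k) {..<k}"
  proof (rule linorder_inj_onI)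
    fix i j assume "i < j" "i \<in> {..<k}" "j \<in> {..<k}"
    then show "(e + 1 + i) mod k \<noteq> (e + 1 + j) mod k"
      using mod_eq_dvd_iff_nat[of "e + 1 + i" "e + 1 + j" k] nat_dvd_not_less[of "j - i" k] by auto
  qed auto
  moreover have "(\<lambda>j. (e + 1 + j) mod k) ` {..<k} \<subseteq> {..<k}" using assms by auto
  ultimately show ?thesis
    by (simp add: bij_betw_def endo_inj_surj)
qed

text \<open>
  Without the edge \<open>e\<close> the cycle is a path that starts at \<open>e + 1\<close> and ends at \<open>e\<close>.
\<close>
lemma cycle_without_edge_integral_le:
  fixes g :: "nat \<Rightarrow> real \<Rightarrow> real \<Rightarrow> ennreal"
  assumes e: "e < k" and W: "W \<in> sets borel"
    and g: "\<And>i. case_prod (g i) \<in> borel_measurable (borel \<Otimes>\<^sub>M borel)"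
    and C: "\<And>i x. (\<integral>\<^sup>+y. g i x y * indicator W y \<partial>lborel) \<le> C"
  shows "(\<integral>\<^sup>+x. (\<Prod>i<k. indicator W (x i)) * (\<Prod>i\<in>{..<k} - {e}. g i (x i) (x ((i + 1) mod k)))
      \<partial>(\<Pi>\<^sub>M i\<in>{..<k}. lborel)) \<le> emeasure lborel W * C ^ (k - 1)"
proof -
  define v where "v j = (e + 1 + j) mod k" for j
  obtain n where k: "k = Suc n" using e by (cases k) auto
  have bij: "bij_betw v {..<k} {..<k}"
    unfolding v_def using rotate_bij_betw[OF e] by simp
  have ns: "{..n} = {..<k}" using k by auto
  have vn: "v n = e"
  proof -
    have "v n = (e + k) mod k" unfolding v_def k by (simp add: ac_simps)
    then show ?thesis using e by simp
  qed
  have vS: "v (Suc j) = (v j + 1) mod k" for j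
    by (simp add: v_def mod_Suc_eq)
  have bij': "bij_betw v {..<n} ({..<k} - {e})"
  proof -
    have "{..<n} = {..<k} - {n}" using k by auto
    then have "v ` {..<n} = v ` ({..<k} - {n})" by (rule arg_cong)
    also have "\<dots> = v ` {..<k} - v ` {n}"
      using bij k by (intro inj_on_image_set_diff[of v "{..<k}"]) (auto simp: bij_betw_def)
    also have "\<dots> = {..<k} - {e}"
      using bij vn by (simp add: bij_betw_def)
    finally have "v ` {..<n} = {..<k} - {e}" .
    moreover have "inj_on v {..<n}" using bij k by (auto simp: bij_betw_def intro: inj_on_subset)
    ultimately show ?thesis by (simp add: bij_betw_def)
  qed
  have 1: "(\<Prod>j\<le>n. indicator W (x (v j))) = (\<Prod>i<k. indicator W (x i) :: ennreal)" for x
    using prod.reindex_bij_betw[OF bij, of "\<lambda>i. indicator W (x i) :: ennreal"] unfolding ns by simp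
  have 2: "(\<Prod>j<n. g (v j) (x (v j)) (x (v (Suc j)))) =
      (\<Prod>i\<in>{..<k} - {e}. g i (x i) (x ((i + 1) mod k)))" for x
    using prod.reindex_bij_betw[OF bij', of "\<lambda>i. g i (x i) (x ((i + 1) mod k))"] by (simp add: vS)
  have im: "v ` {..n} = {..<k}" and inj: "inj_on v {..n}"
    using bij unfolding ns by (simp_all add: bij_betw_def)
  have n: "k - 1 = n" using k by simp
  show ?thesis
    using path_integral_le[of v n W g C, OF inj W g C] unfolding 1 2 im n .
qed

section \<open>Cyclic integrals of the Rosenblatt kernel\<close>

definition cycle_kernel :: "real \<Rightarrow> nat \<Rightarrow> (nat \<Rightarrow> real) \<Rightarrow> real" where
  "cycle_kernel H k x = (\<Prod>i<k. \<bar>x i - x ((i + 1) mod k)\<bar> powr (H - 1))"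

definition cycle_integral :: "real \<Rightarrow> nat \<Rightarrow> (real \<Rightarrow> real) \<Rightarrow> real" where
  "cycle_integral H k f = (\<integral>x. (\<Prod>i<k. f (x i)) * cycle_kernel H k x \<partial>(\<Pi>\<^sub>M i\<in>{..<k}. lborel))"

lemma rosenblatt_R_eq_cycle_integral:
  "rosenblatt_R H k p \<theta> t = cycle_integral H k (step_fun p \<theta> t)"
  by (simp add: rosenblatt_R_def cycle_integral_def cycle_kernel_def)

text \<open>
  Homogeneity turns the cumulant series along a ray into a power series in the scaling parameter.
\<close>
lemma cycle_integral_scale:
  "cycle_integral H k (\<lambda>x. c * f x) = c ^ k * cycle_integral H k f"
  unfolding cycle_integral_def by (simp add: prod.distrib mult.assoc)

lemma cycle_kernel_nonneg: "0 \<le> cycle_kernel H k x"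
  unfolding cycle_kernel_def by (intro prod_nonneg) simp

lemma edge_measurable [measurable]:
  fixes b :: real and k :: nat
  assumes "i < k"
  shows "(\<lambda>x. \<bar>x i - x ((i + 1) mod k)\<bar> powr b) \<in> borel_measurable (\<Pi>\<^sub>M i\<in>{..<k}. lborel)"
proof -
  have "(i + 1) mod k < k" using assms by (intro mod_less_divisor) linarith
  then show ?thesis
    using assms by (intro kernel_component_measurable[of "\<lambda>u v::real. \<bar>u - v\<bar> powr b"]) auto
qed

lemma vertex_measurable:
  assumes "i < k" "f \<in> borel_measurable borel"
  shows "(\<lambda>x. f (x i) :: real) \<in> borel_measurable (\<Pi>\<^sub>M i\<in>{..<k}. lborel)"
  using assms by (intro measurable_compose[OF measurable_component_singleton[of i]]) auto

lemma cycle_kernel_measurable [measurable]: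
  "cycle_kernel H k \<in> borel_measurable (\<Pi>\<^sub>M i\<in>{..<k}. lborel)"
  unfolding cycle_kernel_def[abs_def] by (intro borel_measurable_prod edge_measurable) simp

lemma vertex_prod_measurable [measurable]:
  assumes "f \<in> borel_measurable borel"
  shows "(\<lambda>x. (\<Prod>i<k. f (x i)) :: real) \<in> borel_measurable (\<Pi>\<^sub>M i\<in>{..<k}. lborel)"
  using assms by (intro borel_measurable_prod vertex_measurable) auto

text \<open>
  If \<open>P\<close> were inherited by the cyclic successor, it would spread from one vertex to the whole cycle.
\<close>
lemma cycle_crossing:
  fixes P :: "nat \<Rightarrow> bool"
  assumes "i < k" "P i" "j < k" "\<not> P j"
  shows "\<exists>e<k. P e \<and> \<not> P ((e + 1) mod k)"
proof (rule ccontr)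
  assume neg: "\<not> ?thesis"
  have "P ((i + m) mod k)" for m
  proof (induction m)
    case 0
    then show ?case using assms by simp
  next
    case (Suc m)
    have "(i + m) mod k < k" using assms by simp
    then have "P (((i + m) mod k + 1) mod k)" using neg Suc by blast
    then show ?case by (simp add: mod_Suc_eq)
  qed
  from this[of "k + j - i"] show False using assms by simp
qed

locale hurst =
  fixes H :: real
  assumes H_gt: "1 / 2 < H" and H_lt: "H < 1"
begin

text \<open>
  By \<open>nn_integral_powr_kernel_le\<close> this bounds, for a set of measure at most \<open>w\<close>, the integral over one
  vertex of every kernel \<open>\<bar>x - y\<bar>^b\<close> with \<open>2H - 2 \<le> b \<le> 0\<close>: the kernel itself (\<open>b = H - 1\<close>), its square
  (\<open>b = 2H - 2\<close>) and a deleted edge (\<open>b = 0\<close>).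
\<close>
definition path_const :: "real \<Rightarrow> real" where
  "path_const w = 2 / (2 * H - 1) + w"

lemma path_const_pos: "0 \<le> w \<Longrightarrow> 0 < path_const w"
  using H_gt by (simp add: path_const_def add_pos_nonneg)

lemma le_path_const: "w \<le> path_const w"
  using H_gt by (simp add: path_const_def)

lemma broken_cycle_integral_le:
  assumes e: "e < k" and W: "W \<in> sets borel" "emeasure lborel W \<le> ennreal w" "0 \<le> w"
    and b: "\<And>i. 2 * H - 2 \<le> b i" "\<And>i. b i \<le> 0"
  shows "(\<integral>\<^sup>+x. ennreal ((\<Prod>i<k. indicator W (x i)) *
            (\<Prod>i\<in>{..<k} - {e}. \<bar>x i - x ((i + 1) mod k)\<bar> powr b i))
      \<partial>(\<Pi>\<^sub>M i\<in>{..<k}. lborel)) \<le> ennreal (w * path_const w ^ (k - 1))"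
proof -
  have "(\<integral>\<^sup>+x. ennreal ((\<Prod>i<k. indicator W (x i)) *
            (\<Prod>i\<in>{..<k} - {e}. \<bar>x i - x ((i + 1) mod k)\<bar> powr b i))
      \<partial>(\<Pi>\<^sub>M i\<in>{..<k}. lborel)) =
      (\<integral>\<^sup>+x. (\<Prod>i<k. indicator W (x i)) *
            (\<Prod>i\<in>{..<k} - {e}. ennreal (\<bar>x i - x ((i + 1) mod k)\<bar> powr b i))
      \<partial>(\<Pi>\<^sub>M i\<in>{..<k}. lborel))"
    by (simp add: ennreal_mult prod_nonneg flip: prod_ennreal ennreal_indicator)
  also have "\<dots> \<le> emeasure lborel W * ennreal (path_const w) ^ (k - 1)"
  proof (rule cycle_without_edge_integral_le[OF e W(1), where g = "\<lambda>i u v. ennreal (\<bar>u - v\<bar> powr b i)"])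
    show "(\<lambda>(u, v). ennreal (\<bar>u - v\<bar> powr b i)) \<in> borel_measurable (borel \<Otimes>\<^sub>M borel)" for i
      by measurable
    fix i y
    have b1: "2 * H - 1 \<le> b i + 1" "0 < 2 * H - 1" using b(1)[of i] H_gt by auto
    have "(\<integral>\<^sup>+v. ennreal (\<bar>y - v\<bar> powr b i) * indicator W v \<partial>lborel) \<le> ennreal (2 / (b i + 1) + w)"
      using b1 b(2)[of i] W by (intro nn_integral_powr_kernel_le) auto
    also have "\<dots> \<le> ennreal (path_const w)"
      unfolding path_const_def using b1 by (intro ennreal_leI add_right_mono divide_left_mono) auto
    finally show "(\<integral>\<^sup>+v. ennreal (\<bar>y - v\<bar> powr b i) * indicator W v \<partial>lborel) \<le> ennreal (path_const w)" .
  qed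
  also have "\<dots> \<le> ennreal w * ennreal (path_const w) ^ (k - 1)"
    by (intro mult_right_mono W) auto
  also have "\<dots> = ennreal (w * path_const w ^ (k - 1))"
    using W(3) path_const_pos[OF W(3)] by (simp add: ennreal_mult ennreal_power)
  finally show ?thesis .
qed

text \<open>
  The full cycle cannot be integrated vertex by vertex. The inequality \<open>a b \<le> a^2 + b^2\<close>, used for two
  adjacent edges, deletes one of them at the price of squaring the other; the square is still
  integrable because \<open>2H - 2 > -1\<close>.
\<close>
lemma cycle_kernel_le:
  assumes k: "2 \<le> k"
  defines "P \<equiv> \<lambda>e e' x. \<Prod>i\<in>{..<k} - {e}. \<bar>x i - x ((i + 1) mod k)\<bar> powr (if i = e' then 2 * H - 2 else H - 1)"
  shows "cycle_kernel H k x \<le> P 0 1 x + P 1 0 x"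
proof -
  define a where "a i = \<bar>x i - x ((i + 1) mod k)\<bar>" for i
  define R where "R = (\<Prod>i\<in>{..<k} - {0, 1}. a i powr (H - 1))"
  have R: "0 \<le> R" unfolding R_def by (intro prod_nonneg) simp
  have sq: "a i powr (2 * H - 2) = (a i powr (H - 1))\<^sup>2" for i
    by (simp add: power2_eq_square flip: powr_add)
  have "cycle_kernel H k x = a 0 powr (H - 1) * (a 1 powr (H - 1) * R)"
  proof -
    have "{..<k} - {0} - {1} = {..<k} - {0, 1}" by auto
    then show ?thesis
      unfolding cycle_kernel_def R_def a_def using k
      by (subst prod.remove[of _ 0], simp, simp, subst prod.remove[of _ 1]) auto
  qed
  moreover have "P 0 1 x = a 1 powr (2 * H - 2) * R"
  proof -
    have "P 0 1 x = a 1 powr (2 * H - 2) * (\<Prod>i\<in>{..<k} - {0} - {1}. a i powr (if i = 1 then 2 * H - 2 else H - 1))"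
      unfolding P_def a_def using k by (subst prod.remove[of _ 1]) auto
    also have "(\<Prod>i\<in>{..<k} - {0} - {1}. a i powr (if i = 1 then 2 * H - 2 else H - 1)) = R"
      unfolding R_def by (intro prod.cong) auto
    finally show ?thesis .
  qed
  moreover have "P 1 0 x = a 0 powr (2 * H - 2) * R"
  proof -
    have "P 1 0 x = a 0 powr (2 * H - 2) * (\<Prod>i\<in>{..<k} - {1} - {0}. a i powr (if i = 0 then 2 * H - 2 else H - 1))"
      unfolding P_def a_def using k by (subst prod.remove[of _ 0]) auto
    also have "(\<Prod>i\<in>{..<k} - {1} - {0}. a i powr (if i = 0 then 2 * H - 2 else H - 1)) = R"
      unfolding R_def by (intro prod.cong) auto
    finally show ?thesis .
  qed
  moreover have "a 0 powr (H - 1) * a 1 powr (H - 1) \<le> (a 1 powr (H - 1))\<^sup>2 + (a 0 powr (H - 1))\<^sup>2"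
  proof -
    have "2 * (a 0 powr (H - 1) * a 1 powr (H - 1)) \<le> (a 1 powr (H - 1))\<^sup>2 + (a 0 powr (H - 1))\<^sup>2"
      using zero_le_power2[of "a 0 powr (H - 1) - a 1 powr (H - 1)"] by (simp add: power2_diff)
    moreover have "0 \<le> a 0 powr (H - 1) * a 1 powr (H - 1)" by simp
    ultimately show ?thesis by linarith
  qed
  ultimately show ?thesis
    using mult_right_mono[OF _ R] unfolding sq by (metis mult.assoc distrib_right)
qed

lemma vertex_prod_abs_le:
  fixes f :: "real \<Rightarrow> real"
  assumes "\<And>x. \<bar>f x\<bar> \<le> c * indicator W x"
  shows "\<bar>\<Prod>i<k. f (x i)\<bar> \<le> c ^ k * (\<Prod>i<k. indicator W (x i))"
proof -
  have "\<bar>\<Prod>i<k. f (x i)\<bar> = (\<Prod>i<k. \<bar>f (x i)\<bar>)" by (rule abs_prod)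
  also have "\<dots> \<le> (\<Prod>i<k. c * indicator W (x i))"
    using assms by (intro prod_mono) auto
  finally show ?thesis by (simp add: prod.distrib)
qed

lemma bound_power_le:
  assumes "0 < k" "0 \<le> w" "0 \<le> c"
  shows "c ^ k * (w * path_const w ^ (k - 1)) \<le> (c * path_const w) ^ k"
proof -
  have "w * path_const w ^ (k - 1) \<le> path_const w * path_const w ^ (k - 1)"
    using path_const_pos[OF assms(2)] le_path_const by (intro mult_right_mono) auto
  also have "\<dots> = path_const w ^ k"
    using assms(1) by (cases k) auto
  finally show ?thesis
    using assms(3) by (simp add: power_mult_distrib mult_left_mono)
qed

lemma cycle_integrand_nn_integral_le:
  assumes k: "2 \<le> k" and W: "W \<in> sets borel" "emeasure lborel W \<le> ennreal w" "0 \<le> w"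
    and f: "\<And>x. \<bar>f x\<bar> \<le> c * indicator W x" and c: "0 \<le> c"
  shows "(\<integral>\<^sup>+x. ennreal \<bar>(\<Prod>i<k. f (x i)) * cycle_kernel H k x\<bar> \<partial>(\<Pi>\<^sub>M i\<in>{..<k}. lborel))
    \<le> ennreal (2 * (c * path_const w) ^ k)"
proof -
  define b where "b e' i = (if i = e' then 2 * H - 2 else H - 1)" for e' i :: nat
  define P where "P e e' x = (\<Prod>i<k. indicator W (x i)) *
    (\<Prod>i\<in>{..<k} - {e}. \<bar>x i - x ((i + 1) mod k)\<bar> powr b e' i)" for e e' and x :: "nat \<Rightarrow> real"
  have P0: "0 \<le> P e e' x" for e e' x
    unfolding P_def by (intro mult_nonneg_nonneg prod_nonneg) auto
  have Pm: "P e e' \<in> borel_measurable (\<Pi>\<^sub>M i\<in>{..<k}. lborel)" for e e'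
    unfolding P_def[abs_def] using W(1)
    by (intro borel_measurable_times borel_measurable_prod edge_measurable vertex_measurable) auto
  have PI: "(\<integral>\<^sup>+x. ennreal (P e e' x) \<partial>(\<Pi>\<^sub>M i\<in>{..<k}. lborel)) \<le> ennreal (w * path_const w ^ (k - 1))"
    if "e < k" for e e'
    unfolding P_def using that W H_lt H_gt by (intro broken_cycle_integral_le) (auto simp: b_def)
  have pw: "\<bar>(\<Prod>i<k. f (x i)) * cycle_kernel H k x\<bar> \<le> c ^ k * (P 0 1 x + P 1 0 x)" for x
  proof -
    have "\<bar>(\<Prod>i<k. f (x i)) * cycle_kernel H k x\<bar> = \<bar>\<Prod>i<k. f (x i)\<bar> * cycle_kernel H k x"
      by (simp add: abs_mult cycle_kernel_nonneg)
    also have "\<dots> \<le> (c ^ k * (\<Prod>i<k. indicator W (x i))) * cycle_kernel H k x"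
      by (intro mult_right_mono vertex_prod_abs_le f cycle_kernel_nonneg)
    also have "\<dots> \<le> (c ^ k * (\<Prod>i<k. indicator W (x i))) *
        ((\<Prod>i\<in>{..<k} - {0}. \<bar>x i - x ((i + 1) mod k)\<bar> powr b 1 i) +
         (\<Prod>i\<in>{..<k} - {1}. \<bar>x i - x ((i + 1) mod k)\<bar> powr b 0 i))"
      using cycle_kernel_le[OF k, of x] c unfolding b_def
      by (intro mult_left_mono mult_nonneg_nonneg prod_nonneg) auto
    finally show ?thesis unfolding P_def by (simp add: algebra_simps)
  qed
  have "(\<integral>\<^sup>+x. ennreal \<bar>(\<Prod>i<k. f (x i)) * cycle_kernel H k x\<bar> \<partial>(\<Pi>\<^sub>M i\<in>{..<k}. lborel))
    \<le> (\<integral>\<^sup>+x. ennreal (c ^ k) * (ennreal (P 0 1 x) + ennreal (P 1 0 x)) \<partial>(\<Pi>\<^sub>M i\<in>{..<k}. lborel))"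
    using pw c P0 by (intro nn_integral_mono) (simp add: ennreal_leI flip: ennreal_mult ennreal_plus)
  also have "\<dots> = ennreal (c ^ k) * ((\<integral>\<^sup>+x. ennreal (P 0 1 x) \<partial>(\<Pi>\<^sub>M i\<in>{..<k}. lborel))
       + (\<integral>\<^sup>+x. ennreal (P 1 0 x) \<partial>(\<Pi>\<^sub>M i\<in>{..<k}. lborel)))"
    using Pm by (simp add: nn_integral_cmult nn_integral_add)
  also have "\<dots> \<le> ennreal (c ^ k) * (ennreal (w * path_const w ^ (k - 1)) + ennreal (w * path_const w ^ (k - 1)))"
    using k by (intro mult_left_mono add_mono PI) auto
  also have "\<dots> = ennreal (2 * (c ^ k * (w * path_const w ^ (k - 1))))"
    using c W(3) path_const_pos[OF W(3)] by (simp flip: ennreal_mult ennreal_plus)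
  also have "\<dots> \<le> ennreal (2 * (c * path_const w) ^ k)"
    using bound_power_le[of k w c] k c W(3) by (intro ennreal_leI) auto
  finally show ?thesis .
qed

text \<open>
  This matters because the integral that defines \<open>R_k\<close> is, by convention, \<open>0\<close> for a function that is
  not integrable.
\<close>
lemma cycle_integrable:
  assumes k: "2 \<le> k" and W: "W \<in> sets borel" "emeasure lborel W \<le> ennreal w" "0 \<le> w"
    and f: "\<And>x. \<bar>f x\<bar> \<le> c * indicator W x" "f \<in> borel_measurable borel" and c: "0 \<le> c"
  shows "integrable (\<Pi>\<^sub>M i\<in>{..<k}. lborel) (\<lambda>x. (\<Prod>i<k. f (x i)) * cycle_kernel H k x)"
proof (rule integrableI_bounded)
  show "(\<lambda>x. (\<Prod>i<k. f (x i)) * cycle_kernel H k x) \<in> borel_measurable (\<Pi>\<^sub>M i\<in>{..<k}. lborel)"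
    using f(2) by measurable
  show "(\<integral>\<^sup>+x. ennreal (norm ((\<Prod>i<k. f (x i)) * cycle_kernel H k x)) \<partial>(\<Pi>\<^sub>M i\<in>{..<k}. lborel)) < \<infinity>"
    using cycle_integrand_nn_integral_le[OF k W f(1) c]
    by (simp only: real_norm_def) (rule order.strict_trans1, auto)
qed

lemma abs_cycle_integral_le:
  assumes k: "2 \<le> k" and W: "W \<in> sets borel" "emeasure lborel W \<le> ennreal w" "0 \<le> w"
    and f: "\<And>x. \<bar>f x\<bar> \<le> c * indicator W x" "f \<in> borel_measurable borel" and c: "0 \<le> c"
  shows "\<bar>cycle_integral H k f\<bar> \<le> 2 * (c * path_const w) ^ k"
proof -
  have "ennreal \<bar>cycle_integral H k f\<bar>
      \<le> (\<integral>\<^sup>+x. ennreal \<bar>(\<Prod>i<k. f (x i)) * cycle_kernel H k x\<bar> \<partial>(\<Pi>\<^sub>M i\<in>{..<k}. lborel))"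
    unfolding cycle_integral_def real_norm_def[symmetric]
    by (intro integral_norm_bound_ennreal cycle_integrable[OF k W f c])
  also have "\<dots> \<le> ennreal (2 * (c * path_const w) ^ k)"
    by (rule cycle_integrand_nn_integral_le[OF k W f(1) c])
  finally show ?thesis
    using c path_const_pos[OF W(3)] by (subst (asm) ennreal_le_iff) auto
qed

definition mixed_cycle :: "nat \<Rightarrow> (real \<Rightarrow> real) \<Rightarrow> (real \<Rightarrow> real) \<Rightarrow> real" where
  "mixed_cycle k f g = cycle_integral H k (\<lambda>x. f x + g x) - cycle_integral H k f - cycle_integral H k g"

text \<open>
  The left side vanishes unless all points lie in \<open>A \<union> B\<close> and both sets are visited. In that case
  some edge \<open>e\<close> leads from \<open>A\<close> to \<open>B\<close> and some edge \<open>e'\<close> from \<open>B\<close> to \<open>A\<close>, each of length at least \<open>\<delta>\<close>.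
  The sum over all pairs on the right makes the bound independent of which edges these are; \<open>e\<close> is
  absent from the product and \<open>e'\<close> is neutralized by the exponent \<open>0\<close>.
\<close>
lemma mixed_cycle_integrand_le:
  assumes AB: "A \<inter> B = {}" and sep: "\<And>x y. x \<in> A \<Longrightarrow> y \<in> B \<Longrightarrow> \<delta> \<le> \<bar>x - y\<bar>" and \<delta>: "0 < \<delta>"
    and f: "\<And>x. \<bar>f x\<bar> \<le> c * indicator A x" and g: "\<And>x. \<bar>g x\<bar> \<le> c * indicator B x"
    and c: "0 \<le> c" and k: "0 < k"
  shows "\<bar>((\<Prod>i<k. f (x i) + g (x i)) - (\<Prod>i<k. f (x i)) - (\<Prod>i<k. g (x i))) * cycle_kernel H k x\<bar>
    \<le> (\<Sum>e<k. \<Sum>e'<k. c ^ k * \<delta> powr (2 * H - 2) * ((\<Prod>i<k. indicator (A \<union> B) (x i)) *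
        (\<Prod>i\<in>{..<k} - {e}. \<bar>x i - x ((i + 1) mod k)\<bar> powr (if i = e' then 0 else H - 1))))"
    (is "?L \<le> (\<Sum>e<k. \<Sum>e'<k. ?T e e')")
proof -
  have fz: "f y = 0" if "y \<notin> A" for y using f[of y] that by simp
  have gz: "g y = 0" if "y \<notin> B" for y using g[of y] that by simp
  have zero_le: "0 \<le> (\<Sum>e<k. \<Sum>e'<k. ?T e e')"
    using c by (intro sum_nonneg mult_nonneg_nonneg prod_nonneg) auto
  show ?thesis
  proof (cases "(\<exists>i<k. x i \<in> A) \<and> (\<exists>i<k. x i \<in> B) \<and> (\<forall>i<k. x i \<in> A \<union> B)")
    case True
    then obtain iA iB where i: "iA < k" "x iA \<in> A" "iB < k" "x iB \<in> B" and all: "\<And>i. i < k \<Longrightarrow> x i \<in> A \<union> B"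
      by blast
    obtain e where e: "e < k" "x e \<in> A" "x ((e + 1) mod k) \<notin> A"
      using cycle_crossing[of iA k "\<lambda>i. x i \<in> A" iB] i AB by auto
    obtain e' where e': "e' < k" "x e' \<in> B" "x ((e' + 1) mod k) \<notin> B"
      using cycle_crossing[of iB k "\<lambda>i. x i \<in> B" iA] i AB by auto
    have ne: "e' \<noteq> e" using e e' AB by auto
    have nA: "x ((e + 1) mod k) \<in> B" using e all[of "(e + 1) mod k"] k by auto
    have nB: "x ((e' + 1) mod k) \<in> A" using e' all[of "(e' + 1) mod k"] k by auto
    define a where "a i = \<bar>x i - x ((i + 1) mod k)\<bar>" for i
    have ae: "\<delta> \<le> a e" unfolding a_def using sep[OF e(2) nA] .
    have ae': "\<delta> \<le> a e'" unfolding a_def using sep[OF nB e'(2)] by linarith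
    have fA: "(\<Prod>i<k. f (x i)) = 0"
      using i AB fz by (intro prod_zero) auto
    have gB: "(\<Prod>i<k. g (x i)) = 0"
      using i AB gz by (intro prod_zero) auto
    have "\<bar>f y + g y\<bar> \<le> c * indicator (A \<union> B) y" for y
      using f[of y] g[of y] AB by (cases "y \<in> A"; cases "y \<in> B") auto
    from vertex_prod_abs_le[OF this]
    have vb: "\<bar>\<Prod>i<k. f (x i) + g (x i)\<bar> \<le> c ^ k * (\<Prod>i<k. indicator (A \<union> B) (x i))" .
    define R where "R = (\<Prod>i\<in>{..<k} - {e} - {e'}. a i powr (H - 1))"
    have R: "0 \<le> R" unfolding R_def by (intro prod_nonneg) simp
    have ker: "cycle_kernel H k x = a e powr (H - 1) * (a e' powr (H - 1) * R)"
      unfolding cycle_kernel_def R_def a_def using e e' ne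
      by (subst prod.remove[of _ e], simp, simp, subst prod.remove[of _ e']) auto
    have "(\<Prod>i\<in>{..<k} - {e}. a i powr (if i = e' then 0 else H - 1))
        = a e' powr 0 * (\<Prod>i\<in>{..<k} - {e} - {e'}. a i powr (if i = e' then 0 else H - 1))"
      using e' ne by (subst prod.remove[of _ e']) auto
    also have "(\<Prod>i\<in>{..<k} - {e} - {e'}. a i powr (if i = e' then 0 else H - 1)) = R"
      unfolding R_def by (intro prod.cong) auto
    finally have rest: "(\<Prod>i\<in>{..<k} - {e}. a i powr (if i = e' then 0 else H - 1)) = R"
      using ae' \<delta> by simp
    have d: "a j powr (H - 1) \<le> \<delta> powr (H - 1)" if "\<delta> \<le> a j" for j
      using that \<delta> H_lt by (intro powr_mono2') auto
    have "cycle_kernel H k x \<le> \<delta> powr (H - 1) * (\<delta> powr (H - 1) * R)"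
      unfolding ker by (intro mult_mono mult_right_mono d ae ae' R) (auto simp: R)
    also have "\<dots> = \<delta> powr (2 * H - 2) * R"
      by (simp add: mult.assoc[symmetric] flip: powr_add)
    finally have kb: "cycle_kernel H k x \<le> \<delta> powr (2 * H - 2) * R" .
    have "?L = \<bar>\<Prod>i<k. f (x i) + g (x i)\<bar> * cycle_kernel H k x"
      unfolding fA gB by (simp add: abs_mult cycle_kernel_nonneg)
    also have "\<dots> \<le> (c ^ k * (\<Prod>i<k. indicator (A \<union> B) (x i))) * (\<delta> powr (2 * H - 2) * R)"
      using c by (intro mult_mono vb kb cycle_kernel_nonneg mult_nonneg_nonneg prod_nonneg) auto
    also have "\<dots> = ?T e e'"
      using rest unfolding a_def by (simp add: mult_ac)
    also have "\<dots> \<le> (\<Sum>e'<k. ?T e e')"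
      using c e' by (intro member_le_sum mult_nonneg_nonneg prod_nonneg) auto
    also have "\<dots> \<le> (\<Sum>e<k. \<Sum>e'<k. ?T e e')"
      using c e by (intro member_le_sum sum_nonneg mult_nonneg_nonneg prod_nonneg) auto
    finally show ?thesis .
  next
    case False
    have "((\<Prod>i<k. f (x i) + g (x i)) - (\<Prod>i<k. f (x i)) - (\<Prod>i<k. g (x i))) = 0"
    proof (cases "\<forall>i<k. x i \<in> A \<union> B")
      case True
      then consider "\<forall>i<k. x i \<in> A" | "\<forall>i<k. x i \<in> B" using False by blast
      then show ?thesis
      proof cases
        case 1
        then have "x i \<notin> B" if "i < k" for i using AB that by auto
        then have "(\<Prod>i<k. f (x i) + g (x i)) = (\<Prod>i<k. f (x i))" "(\<Prod>i<k. g (x i)) = 0"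
          using gz k by (auto intro!: prod.cong prod_zero)
        then show ?thesis by simp
      next
        case 2
        then have "x i \<notin> A" if "i < k" for i using AB that by auto
        then have "(\<Prod>i<k. f (x i) + g (x i)) = (\<Prod>i<k. g (x i))" "(\<Prod>i<k. f (x i)) = 0"
          using fz k by (auto intro!: prod.cong prod_zero)
        then show ?thesis by simp
      qed
    next
      case False
      then obtain i where "i < k" "x i \<notin> A" "x i \<notin> B" by auto
      then have "(\<Prod>i<k. f (x i) + g (x i)) = 0" "(\<Prod>i<k. f (x i)) = 0" "(\<Prod>i<k. g (x i)) = 0"
        using fz gz by (auto intro!: prod_zero bexI[of _ i])
      then show ?thesis by (simp only: diff_zero)
    qed
    then have "?L = 0" by simp
    then show ?thesis using zero_le by linarith
  qed
qed

lemma abs_mixed_cycle_le: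
  assumes k: "2 \<le> k" and AB: "A \<inter> B = {}" and sep: "\<And>x y. x \<in> A \<Longrightarrow> y \<in> B \<Longrightarrow> \<delta> \<le> \<bar>x - y\<bar>" and \<delta>: "0 < \<delta>"
    and AB_borel: "A \<in> sets borel" "B \<in> sets borel" and w: "emeasure lborel (A \<union> B) \<le> ennreal w" "0 \<le> w"
    and f: "\<And>x. \<bar>f x\<bar> \<le> c * indicator A x" and g: "\<And>x. \<bar>g x\<bar> \<le> c * indicator B x"
    and fm[measurable]: "f \<in> borel_measurable borel" and gm[measurable]: "g \<in> borel_measurable borel" and c: "0 \<le> c"
  shows "\<bar>mixed_cycle k f g\<bar> \<le> (real k)\<^sup>2 * (c * path_const w) ^ k * \<delta> powr (2 * H - 2)"
proof -
  let ?M = "\<Pi>\<^sub>M i\<in>{..<k}. (lborel :: real measure)"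
  define W where "W = A \<union> B"
  have W: "W \<in> sets borel" "emeasure lborel W \<le> ennreal w"
    using AB_borel w by (auto simp: W_def)
  have fg: "\<bar>f y + g y\<bar> \<le> c * indicator W y" "\<bar>f y\<bar> \<le> c * indicator W y" "\<bar>g y\<bar> \<le> c * indicator W y" for y
    using f[of y] g[of y] AB c by (cases "y \<in> A"; cases "y \<in> B"; auto simp: W_def)+
  define P where "P e e' x = ((\<Prod>i<k. indicator W (x i)) *
    (\<Prod>i\<in>{..<k} - {e}. \<bar>x i - x ((i + 1) mod k)\<bar> powr (if i = e' then 0 else H - 1)))"
    for e e' and x :: "nat \<Rightarrow> real"
  define D where "D x = ((\<Prod>i<k. f (x i) + g (x i)) - (\<Prod>i<k. f (x i)) - (\<Prod>i<k. g (x i))) * cycle_kernel H k x"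
    for x
  define q where "q = c ^ k * \<delta> powr (2 * H - 2)"
  have q: "0 \<le> q" using c by (simp add: q_def)
  have P0: "0 \<le> P e e' x" for e e' x
    unfolding P_def by (intro mult_nonneg_nonneg prod_nonneg) auto
  have Pm: "P e e' \<in> borel_measurable ?M" for e e'
    unfolding P_def[abs_def] using W(1)
    by (intro borel_measurable_times borel_measurable_prod edge_measurable vertex_measurable) auto
  have PI: "(\<integral>\<^sup>+x. ennreal (P e e' x) \<partial>?M) \<le> ennreal (w * path_const w ^ (k - 1))"
    if "e < k" for e e'
    unfolding P_def using that W w H_lt H_gt by (intro broken_cycle_integral_le) auto
  have "integrable ?M (\<lambda>x. (\<Prod>i<k. h (x i)) * cycle_kernel H k x)"
    if "\<And>y. \<bar>h y\<bar> \<le> c * indicator W y" "h \<in> borel_measurable borel" for h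
    using that k W w(2) c by (intro cycle_integrable)
  note int = this[OF fg(1)] this[OF fg(2)] this[OF fg(3)]
  have eq: "mixed_cycle k f g = (\<integral>x. D x \<partial>?M)"
    unfolding mixed_cycle_def cycle_integral_def D_def left_diff_distrib
    using int by (simp add: Bochner_Integration.integral_diff Bochner_Integration.integrable_diff)
  have "integrable ?M D"
    unfolding D_def[abs_def] left_diff_distrib using int fm gm by (intro Bochner_Integration.integrable_diff) auto
  then have "ennreal \<bar>mixed_cycle k f g\<bar> \<le> (\<integral>\<^sup>+x. ennreal \<bar>D x\<bar> \<partial>?M)"
    unfolding eq real_norm_def[symmetric] by (rule integral_norm_bound_ennreal)
  also have "\<dots> \<le> (\<integral>\<^sup>+x. (\<Sum>e<k. \<Sum>e'<k. ennreal q * ennreal (P e e' x)) \<partial>?M)"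
  proof (intro nn_integral_mono)
    fix x
    have "\<bar>D x\<bar> \<le> (\<Sum>e<k. \<Sum>e'<k. q * P e e' x)"
      using mixed_cycle_integrand_le[OF AB sep \<delta> f g c, of k x] k
      unfolding D_def P_def W_def q_def by simp
    then have "ennreal \<bar>D x\<bar> \<le> ennreal (\<Sum>e<k. \<Sum>e'<k. q * P e e' x)" by (rule ennreal_leI)
    also have "\<dots> = (\<Sum>e<k. \<Sum>e'<k. ennreal q * ennreal (P e e' x))"
      using q P0 by (simp add: sum_nonneg flip: sum_ennreal ennreal_mult)
    finally show "ennreal \<bar>D x\<bar> \<le> (\<Sum>e<k. \<Sum>e'<k. ennreal q * ennreal (P e e' x))" .
  qed
  also have "\<dots> = (\<Sum>e<k. \<Sum>e'<k. ennreal q * (\<integral>\<^sup>+x. ennreal (P e e' x) \<partial>?M))"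
    using Pm by (simp add: nn_integral_sum nn_integral_cmult)
  also have "\<dots> \<le> (\<Sum>e<k. \<Sum>e'<k. ennreal q * ennreal (w * path_const w ^ (k - 1)))"
    by (intro sum_mono mult_left_mono PI) auto
  also have "\<dots> = ennreal ((real k)\<^sup>2 * (q * (w * path_const w ^ (k - 1))))"
    using q w(2) path_const_pos[OF w(2)]
    by (simp add: power2_eq_square mult.assoc ennreal_mult ennreal_of_nat_eq_real_of_nat)
  also have "\<dots> \<le> ennreal ((real k)\<^sup>2 * (c * path_const w) ^ k * \<delta> powr (2 * H - 2))"
  proof (rule ennreal_leI)
    have "q * (w * path_const w ^ (k - 1)) = (c ^ k * (w * path_const w ^ (k - 1))) * \<delta> powr (2 * H - 2)"
      by (simp add: q_def mult_ac)
    also have "\<dots> \<le> (c * path_const w) ^ k * \<delta> powr (2 * H - 2)"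
      using bound_power_le[of k w c] k w(2) c by (intro mult_right_mono) auto
    finally show "(real k)\<^sup>2 * (q * (w * path_const w ^ (k - 1))) \<le> (real k)\<^sup>2 * (c * path_const w) ^ k * \<delta> powr (2 * H - 2)"
      by (simp add: mult.assoc mult_left_mono)
  qed
  finally show ?thesis
    using c path_const_pos[OF w(2)] by (subst (asm) ennreal_le_iff) auto
qed

text \<open>
  For two points both edges of the cycle join the same pair, so the kernel is \<open>\<bar>x - y\<bar>^(2H-2)\<close>, which
  is at least \<open>d^(2H-2)\<close> between \<open>A\<close> and \<open>B\<close>. The factor \<open>2\<close> counts which of the two points is in \<open>A\<close>.
\<close>
lemma mixed_cycle_2_ge:
  assumes AB: "A \<inter> B = {}" and near: "\<And>x y. x \<in> A \<Longrightarrow> y \<in> B \<Longrightarrow> \<bar>x - y\<bar> \<le> d"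
    and AB_borel: "A \<in> sets borel" "B \<in> sets borel"
    and meas: "emeasure lborel A = ennreal a" "emeasure lborel B = ennreal b" "0 \<le> a" "0 \<le> b" and z: "0 \<le> z"
  shows "2 * z\<^sup>2 * (a * b) * d powr (2 * H - 2) \<le> mixed_cycle 2 (\<lambda>x. z * indicator A x) (\<lambda>x. z * indicator B x)"
proof -
  let ?M = "\<Pi>\<^sub>M i\<in>{..<2::nat}. (lborel :: real measure)"
  interpret product_sigma_finite "\<lambda>_::nat. lborel :: real measure" ..
  have two: "{..<2::nat} = {0, 1}" by auto
  define W where "W = A \<union> B"
  have W: "W \<in> sets borel" "emeasure lborel W \<le> ennreal (a + b)" "0 \<le> a + b"
    using AB_borel meas AB by (auto simp: W_def plus_emeasure[symmetric])
  define f where "f x = z * indicator A x" for x :: real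
  define g where "g x = z * indicator B x" for x :: real
  have fg: "\<bar>f y + g y\<bar> \<le> z * indicator W y" "\<bar>f y\<bar> \<le> z * indicator W y" "\<bar>g y\<bar> \<le> z * indicator W y" for y
    using AB z by (cases "y \<in> A"; cases "y \<in> B"; auto simp: W_def f_def g_def)+
  have fgm: "f \<in> borel_measurable borel" "g \<in> borel_measurable borel"
    using AB_borel by (auto simp: f_def[abs_def] g_def[abs_def])
  have "integrable ?M (\<lambda>x. (\<Prod>i<2. h (x i)) * cycle_kernel H 2 x)"
    if "\<And>y. \<bar>h y\<bar> \<le> z * indicator W y" "h \<in> borel_measurable borel" for h
    using that W z by (intro cycle_integrable[where W = W and w = "a + b" and c = z]) auto
  note int = this[OF fg(1)] this[OF fg(2)] this[OF fg(3)]
  define D where "D x = (\<Prod>i<2. f (x i) + g (x i)) * cycle_kernel H 2 x - (\<Prod>i<2. f (x i)) * cycle_kernel H 2 x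
      - (\<Prod>i<2. g (x i)) * cycle_kernel H 2 x"
    for x
  have eq: "mixed_cycle 2 f g = (\<integral>x. D x \<partial>?M)"
    unfolding mixed_cycle_def cycle_integral_def D_def
    using int fgm by (simp add: Bochner_Integration.integral_diff Bochner_Integration.integrable_diff)
  have Dint: "integrable ?M D"
    unfolding D_def[abs_def] using int fgm by (intro Bochner_Integration.integrable_diff) auto
  define E where "E x = (\<Prod>i\<in>{..<2}. (if i = 0 then indicator A else indicator B) (x i)) +
      (\<Prod>i\<in>{..<2}. (if i = 0 then indicator B else indicator A) (x i) :: real)" for x :: "nat \<Rightarrow> real"
  have iA: "integrable lborel (indicator A :: real \<Rightarrow> real)" "integral\<^sup>L lborel (indicator A :: real \<Rightarrow> real) = a"
    using AB_borel meas by (auto simp: integrable_indicator_iff measure_def)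
  have iB: "integrable lborel (indicator B :: real \<Rightarrow> real)" "integral\<^sup>L lborel (indicator B :: real \<Rightarrow> real) = b"
    using AB_borel meas by (auto simp: integrable_indicator_iff measure_def)
  have E1: "integrable ?M (\<lambda>x. \<Prod>i\<in>{..<2}. (if i = 0 then indicator S else indicator T) (x i) :: real)"
    and E2: "(\<integral>x. (\<Prod>i\<in>{..<2}. (if i = 0 then indicator S else indicator T) (x i) :: real) \<partial>?M) =
       integral\<^sup>L lborel (indicator S :: real \<Rightarrow> real) * integral\<^sup>L lborel (indicator T :: real \<Rightarrow> real)"
    if "integrable lborel (indicator S :: real \<Rightarrow> real)" "integrable lborel (indicator T :: real \<Rightarrow> real)" for S T
    subgoal using that by (intro product_integrable_prod) auto
    subgoal using that by (subst product_integral_prod) (auto simp: two)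
    done
  have Eint: "integrable ?M E" "(\<integral>x. E x \<partial>?M) = 2 * (a * b)"
    unfolding E_def[abs_def] using E1[OF iA(1) iB(1)] E1[OF iB(1) iA(1)] E2[OF iA(1) iB(1)] E2[OF iB(1) iA(1)]
    using AB_borel meas by (simp_all add: measure_def)
  have ck: "cycle_kernel H 2 x = \<bar>x 0 - x 1\<bar> powr (2 * H - 2)" for x
    by (simp add: cycle_kernel_def two abs_minus_commute flip: powr_add)
  have "z\<^sup>2 * d powr (2 * H - 2) * E x \<le> D x" for x
  proof -
    have nAB: "y \<in> A \<Longrightarrow> y \<notin> B" for y using AB by auto
    have key: "z\<^sup>2 * d powr (2 * H - 2) \<le> z\<^sup>2 * \<bar>u - v\<bar> powr (2 * H - 2)"
      if "u \<in> A \<and> v \<in> B \<or> u \<in> B \<and> v \<in> A" for u v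
    proof -
      have "\<bar>u - v\<bar> \<le> d" using near[of u v] near[of v u] that by (auto simp: abs_minus_commute)
      moreover have "0 < \<bar>u - v\<bar>" using that nAB by auto
      ultimately show ?thesis using H_lt by (intro mult_left_mono powr_mono2') auto
    qed
    show ?thesis
      using key[of "x 0" "x 1"] nAB[of "x 0"] nAB[of "x 1"]
      by (cases "x 0 \<in> A"; cases "x 1 \<in> A"; cases "x 0 \<in> B"; cases "x 1 \<in> B")
        (auto simp: D_def E_def ck two f_def g_def power2_eq_square algebra_simps)
  qed
  then have "(\<integral>x. z\<^sup>2 * d powr (2 * H - 2) * E x \<partial>?M) \<le> (\<integral>x. D x \<partial>?M)"
    using Eint Dint by (intro integral_mono) auto
  then show ?thesis
    using Eint eq unfolding f_def g_def by (simp add: mult_ac)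
qed

end

section \<open>Characteristic functions with a local holomorphic extension\<close>

text \<open>
  Iterated central differences are used in place of derivatives, since they exist without any
  moment assumption: applied to \<open>exp (\<i> x X)\<close> they produce the bounded factor \<open>(2 \<i> sin (h X))^n\<close>, and
  applied to a holomorphic function they are controlled by its \<open>n\<close>-th derivative.
\<close>
definition sym_diff :: "real \<Rightarrow> (complex \<Rightarrow> complex) \<Rightarrow> complex \<Rightarrow> complex" where
  "sym_diff h f z = f (z + of_real h) - f (z - of_real h)"

text \<open>
  The \<open>n\<close>-th difference at a real point samples the function only at real points within distance
  \<open>n h\<close>, where the characteristic function is known to agree with its extension.
\<close>
lemma sym_diff_power_cong:
  assumes "\<And>y. \<bar>y\<bar> < \<epsilon> \<Longrightarrow> f (of_real y) = g (of_real y)" and "\<bar>x\<bar> + real n * h < \<epsilon>" and "0 \<le> h"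
  shows "(sym_diff h ^^ n) f (of_real x) = (sym_diff h ^^ n) g (of_real x)"
  using assms(2)
proof (induction n arbitrary: x)
  case 0
  then show ?case using assms(1) by simp
next
  case (Suc n)
  have "\<bar>x + h\<bar> + real n * h < \<epsilon>" "\<bar>x - h\<bar> + real n * h < \<epsilon>"
    using Suc.prems assms(3) by (auto simp: algebra_simps)
  from this[THEN Suc.IH] show ?case
    by (simp add: sym_diff_def)
qed

lemma sym_diff_power_has_derivative:
  assumes "\<And>z. norm z < s \<Longrightarrow> (f has_field_derivative f' z) (at z)" and "norm z + real n * h < s" and "0 \<le> h"
  shows "((sym_diff h ^^ n) f has_field_derivative (sym_diff h ^^ n) f' z) (at z)"
  using assms(2)
proof (induction n arbitrary: z)
  case 0
  then show ?case using assms(1) by simp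
next
  case (Suc n)
  have "norm (z + of_real h) \<le> norm z + h" "norm (z - of_real h) \<le> norm z + h"
    using norm_triangle_ineq[of z "of_real h"] norm_triangle_ineq4[of z "of_real h"] assms(3) by auto
  then have 1: "norm (z + of_real h) + real n * h < s" and 2: "norm (z - of_real h) + real n * h < s"
    using Suc.prems by (auto simp: algebra_simps)
  have "((\<lambda>z. (sym_diff h ^^ n) f (z + of_real h)) has_field_derivative (sym_diff h ^^ n) f' (z + of_real h)) (at z)"
    using Suc.IH[OF 1] by (simp add: DERIV_shift)
  moreover have "((\<lambda>z. (sym_diff h ^^ n) f (z - of_real h)) has_field_derivative (sym_diff h ^^ n) f' (z - of_real h)) (at z)"
    using Suc.IH[OF 2] DERIV_shift[of "(sym_diff h ^^ n) f" _ z "- of_real h"] by simp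
  ultimately show ?case
    unfolding funpow.simps comp_def sym_diff_def[abs_def] by (rule DERIV_diff)
qed

text \<open>
  Each difference is a mean value argument over a segment of length \<open>2 h\<close>, because differences commute
  with derivatives.
\<close>
lemma norm_sym_diff_power_le:
  assumes "\<And>j z. norm z < s \<Longrightarrow> (F j has_field_derivative F (Suc j) z) (at z)"
    and "\<And>z. norm z < s \<Longrightarrow> norm (F (j + n) z) \<le> B" and "norm z + real n * h < s" and "0 \<le> h"
  shows "norm ((sym_diff h ^^ n) (F j) z) \<le> (2 * h) ^ n * B"
  using assms(2,3)
proof (induction n arbitrary: j z)
  case 0
  then show ?case by simp
next
  case (Suc n)
  have B: "\<And>z. norm z < s \<Longrightarrow> norm (F (Suc j + n) z) \<le> B" using Suc.prems(1) by simp
  have seg: "norm y + real n * h < s" if "y \<in> closed_segment (z - of_real h) (z + of_real h)" for y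
  proof -
    have "norm (y - z) \<le> h"
    proof -
      have "closed_segment (z - of_real h) (z + of_real h) \<subseteq> cball z h"
        using assms(4) by (intro closed_segment_subset) (auto simp: dist_norm)
      then show ?thesis using that by (auto simp: dist_norm norm_minus_commute)
    qed
    then have "norm y \<le> norm z + h" using norm_triangle_sub[of y z] by simp
    then show ?thesis using Suc.prems(2) by (simp add: algebra_simps)
  qed
  have "norm ((sym_diff h ^^ n) (F j) (z + of_real h) - (sym_diff h ^^ n) (F j) (z - of_real h))
      \<le> (2 * h) ^ n * B * norm ((z + of_real h) - (z - of_real h))"
  proof (rule field_differentiable_bound[where S = "closed_segment (z - of_real h) (z + of_real h)"
        and f' = "(sym_diff h ^^ n) (F (Suc j))"])
    fix y assume y: "y \<in> closed_segment (z - of_real h) (z + of_real h)"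
    show "((sym_diff h ^^ n) (F j) has_field_derivative (sym_diff h ^^ n) (F (Suc j)) y)
        (at y within closed_segment (z - of_real h) (z + of_real h))"
      by (rule has_field_derivative_at_within, rule sym_diff_power_has_derivative[OF assms(1) seg[OF y] assms(4)])
    show "norm ((sym_diff h ^^ n) (F (Suc j)) y) \<le> (2 * h) ^ n * B"
      by (rule Suc.IH[OF B seg[OF y]])
  qed auto
  also have "norm ((z + of_real h) - (z - of_real h)) = 2 * h"
    using assms(4) by (simp add: norm_mult)
  finally show ?case by (simp add: sym_diff_def mult_ac)
qed

text \<open>
  Cauchy's inequality on circles of a fixed radius \<open>\<rho>\<close> whose centers vary in a small disc. A bound at
  \<open>0\<close> alone would not do, because differences involve derivatives at nearby points.
\<close>
lemma higher_deriv_bound_near_0: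
  fixes F :: "complex \<Rightarrow> complex"
  assumes F: "F holomorphic_on ball 0 R" and \<rho>: "0 < \<rho>" "\<rho> < R"
  shows "\<exists>s M. 0 < s \<and> s \<le> R \<and> 0 \<le> M \<and>
    (\<forall>n z. norm z < s \<longrightarrow> norm ((deriv ^^ n) F z) \<le> fact n * M / \<rho> ^ n)"
proof -
  define r where "r = (\<rho> + R) / 2"
  have r: "\<rho> < r" "r < R" using \<rho> by (auto simp: r_def)
  have "continuous_on (cball 0 r) F"
    using r by (intro holomorphic_on_imp_continuous_on holomorphic_on_subset[OF F]) auto
  then have "bounded (F ` cball 0 r)"
    by (intro compact_imp_bounded compact_continuous_image) auto
  then obtain M where "\<forall>y\<in>F ` cball 0 r. norm y \<le> M"
    unfolding bounded_iff by blast
  then have M: "\<And>z. z \<in> cball 0 r \<Longrightarrow> norm (F z) \<le> M"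
    by blast
  have "0 \<le> M" using order_trans[OF norm_ge_zero M[of 0]] r \<rho> by simp
  moreover have "norm ((deriv ^^ n) F z) \<le> fact n * M / \<rho> ^ n" if z: "norm z < r - \<rho>" for n z
  proof (rule Cauchy_inequality)
    have sub: "cball z \<rho> \<subseteq> cball 0 r"
    proof
      fix w assume "w \<in> cball z \<rho>"
      then have "norm (w - z) \<le> \<rho>" by (simp add: dist_norm norm_minus_commute)
      then show "w \<in> cball 0 r" using z norm_triangle_sub[of w z] by simp
    qed
    have "cball 0 r \<subseteq> ball (0 :: complex) R"
      using r by auto
    then have "F holomorphic_on cball z \<rho>"
      using sub by (intro holomorphic_on_subset[OF F]) blast
    then show "F holomorphic_on ball z \<rho>" and "continuous_on (cball z \<rho>) F"
      by (auto intro: holomorphic_on_subset holomorphic_on_imp_continuous_on)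
    show "norm (F x) \<le> M" if "norm (z - x) = \<rho>" for x
      using that sub by (intro M) (auto simp: subset_iff dist_norm)
  qed (use \<rho> in auto)
  ultimately show ?thesis using r \<rho> by (intro exI[of _ "r - \<rho>"] exI[of _ M]) auto
qed

context prob_space
begin

text \<open>
  Only real arguments matter, but central differences act on functions of a complex variable; taking
  the real part extends the characteristic function without any integrability requirement.
\<close>
lemma sym_diff_power_char:
  assumes [measurable]: "X \<in> borel_measurable M"
  shows "(sym_diff h ^^ n) (\<lambda>z. expectation (\<lambda>\<omega>. exp (\<i> * of_real (Re z * X \<omega>)))) =
    (\<lambda>z. expectation (\<lambda>\<omega>. (2 * \<i> * of_real (sin (h * X \<omega>))) ^ n * exp (\<i> * of_real (Re z * X \<omega>))))"
proof (induction n)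
  case 0
  then show ?case by simp
next
  case (Suc n)
  show ?case
  proof
    fix z
    let ?g = "\<lambda>y \<omega>. (2 * \<i> * of_real (sin (h * X \<omega>))) ^ n * exp (\<i> * of_real (y * X \<omega>))"
    have int: "integrable M (?g y)" for y
    proof (rule integrable_const_bound[where B = "2 ^ n"])
      show "AE \<omega> in M. norm (?g y \<omega>) \<le> 2 ^ n"
        by (intro AE_I2) (auto simp: norm_mult norm_power power_mult_distrib intro!: mult_left_le power_le_one)
    qed measurable
    have pw: "?g (Re z + h) \<omega> - ?g (Re z - h) \<omega> =
        (2 * \<i> * of_real (sin (h * X \<omega>))) ^ Suc n * exp (\<i> * of_real (Re z * X \<omega>))" for \<omega>
    proof -
      define a where "a = \<i> * of_real (Re z * X \<omega>)"
      define b where "b = \<i> * of_real (h * X \<omega>)"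
      define c where "c = 2 * \<i> * of_real (sin (h * X \<omega>))"
      have eb: "exp b - exp (- b) = c"
        unfolding b_def c_def by (subst sin_of_real[symmetric], subst sin_exp_eq) simp
      have ab: "\<i> * of_real ((Re z + h) * X \<omega>) = a + b" "\<i> * of_real ((Re z - h) * X \<omega>) = a - b"
        by (simp_all add: a_def b_def algebra_simps)
      have "c ^ n * exp (a + b) - c ^ n * exp (a - b) = c ^ n * (exp a * (exp b - exp (- b)))"
        by (simp add: exp_add exp_diff exp_minus field_simps)
      also have "\<dots> = c ^ Suc n * exp a"
        by (simp add: eb)
      finally show ?thesis
        by (simp only: ab c_def[symmetric] a_def[symmetric])
    qed
    have "expectation (?g (Re z + h)) - expectation (?g (Re z - h)) = expectation (\<lambda>\<omega>. ?g (Re z + h) \<omega> - ?g (Re z - h) \<omega>)"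
      by (rule Bochner_Integration.integral_diff[OF int int, symmetric])
    then show "(sym_diff h ^^ Suc n) (\<lambda>z. expectation (\<lambda>\<omega>. exp (\<i> * of_real (Re z * X \<omega>)))) z =
      expectation (\<lambda>\<omega>. (2 * \<i> * of_real (sin (h * X \<omega>))) ^ Suc n * exp (\<i> * of_real (Re z * X \<omega>)))"
      unfolding funpow.simps comp_def Suc.IH sym_diff_def
      by (simp only: pw plus_complex.simps minus_complex.simps Re_complex_of_real)
  qed
qed

text \<open>
  The central difference of order \<open>2n\<close> at \<open>0\<close>, divided by \<open>(2h)^(2n)\<close>, is up to sign the expectation of
  \<open>(sin (h X) / h)^(2n)\<close>. It is bounded by the derivative of order \<open>2n\<close> of \<open>F\<close> near \<open>0\<close>, hence by
  Cauchy's inequality, and as \<open>h\<close> tends to \<open>0\<close> Fatou's lemma turns this into a bound on the moment.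
\<close>
lemma even_moments_le:
  assumes [measurable]: "X \<in> borel_measurable M"
    and F: "F holomorphic_on ball 0 R" and \<rho>: "0 < \<rho>" "\<rho> < R" and \<epsilon>: "0 < \<epsilon>"
    and char: "\<And>x. \<bar>x\<bar> < \<epsilon> \<Longrightarrow> expectation (\<lambda>\<omega>. exp (\<i> * of_real (x * X \<omega>))) = F (of_real x)"
  shows "\<exists>B\<ge>0. \<forall>n. (\<integral>\<^sup>+\<omega>. ennreal (X \<omega> ^ (2 * n)) \<partial>M) \<le> ennreal (fact (2 * n) * B / \<rho> ^ (2 * n))"
proof -
  obtain s B where s: "0 < s" "0 \<le> B" "s \<le> R"
    and sB: "\<And>n z. norm z < s \<Longrightarrow> norm ((deriv ^^ n) F z) \<le> fact n * B / \<rho> ^ n"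
    using higher_deriv_bound_near_0[OF F \<rho>] by auto
  have dF: "((deriv ^^ j) F has_field_derivative (deriv ^^ Suc j) F z) (at z)" if "norm z < s" for j z
    using that s by (intro has_field_derivative_higher_deriv[OF F]) auto
  have "(\<integral>\<^sup>+\<omega>. ennreal (X \<omega> ^ (2 * n)) \<partial>M) \<le> ennreal (fact (2 * n) * B / \<rho> ^ (2 * n))" for n
  proof -
    define c where "c = fact (2 * n) * B / \<rho> ^ (2 * n)"
    \<comment> \<open>The \<open>2n\<close> steps of length \<open>h m\<close> stay in the region of agreement (\<open>\<epsilon>\<close>) and of the derivative bound (\<open>s\<close>).\<close>
    define h where "h m = min \<epsilon> s / (2 * real n + 1) / real (m + 1)" for m
    have h0: "0 < h m" for m using \<epsilon> s by (simp add: h_def)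
    have hs: "real (2 * n) * h m < min \<epsilon> s" for m
    proof -
      have "h m \<le> min \<epsilon> s / (2 * real n + 1)"
        using \<epsilon> s unfolding h_def by (intro divide_left_mono[of 1, simplified]) (auto simp: field_simps)
      then have "real (2 * n) * h m \<le> real (2 * n) * (min \<epsilon> s / (2 * real n + 1))"
        by (intro mult_left_mono) auto
      also have "\<dots> < min \<epsilon> s"
      proof -
        have lt: "real (2 * n) * (u / (2 * real n + 1)) < u" if "0 < u" for u :: real
          using that by (simp add: field_simps)
        show ?thesis using \<epsilon> s by (intro lt) simp
      qed
      finally show ?thesis .
    qed
    have hlim: "h \<longlonglongrightarrow> 0"
      unfolding h_def[abs_def] using tendsto_mult[OF tendsto_const LIMSEQ_inverse_real_of_nat] by (simp add: divide_inverse)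
    have "eventually (\<lambda>m. h m \<noteq> 0) sequentially"
      using h0 by (simp add: less_imp_neq[symmetric])
    then have hat: "filterlim h (at 0) sequentially"
      using hlim by (intro filterlim_atI)
    have le: "(\<integral>\<^sup>+\<omega>. ennreal ((sin (h m * X \<omega>) / h m) ^ (2 * n)) \<partial>M) \<le> ennreal c" for m
    proof -
      let ?\<phi> = "\<lambda>z. expectation (\<lambda>\<omega>. exp (\<i> * of_real (Re z * X \<omega>)))"
      have int: "integrable M (\<lambda>\<omega>. sin (h m * X \<omega>) ^ (2 * n))"
        by (rule integrable_const_bound[where B = 1]) (auto simp: power_abs intro!: power_le_one)
      have "(2 * h m) ^ (2 * n) * expectation (\<lambda>\<omega>. (sin (h m * X \<omega>) / h m) ^ (2 * n))
          = norm (expectation (\<lambda>\<omega>. (2 * \<i> * of_real (sin (h m * X \<omega>))) ^ (2 * n)))"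
      proof -
        have "(2 * \<i> * of_real (sin (h m * X \<omega>))) ^ (2 * n)
            = (- 4) ^ n * complex_of_real (sin (h m * X \<omega>) ^ (2 * n))" for \<omega>
        proof -
          have "(2 * \<i> * complex_of_real y)\<^sup>2 = - 4 * of_real (y\<^sup>2)" for y
            by (simp add: power_mult_distrib)
          then show ?thesis by (simp only: power_mult power_mult_distrib of_real_power)
        qed
        then have "norm (expectation (\<lambda>\<omega>. (2 * \<i> * of_real (sin (h m * X \<omega>))) ^ (2 * n)))
            = 4 ^ n * \<bar>expectation (\<lambda>\<omega>. sin (h m * X \<omega>) ^ (2 * n))\<bar>"
          by (simp add: norm_mult norm_power del: of_real_power)
        also have "\<bar>expectation (\<lambda>\<omega>. sin (h m * X \<omega>) ^ (2 * n))\<bar> = expectation (\<lambda>\<omega>. sin (h m * X \<omega>) ^ (2 * n))"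
          by (intro abs_of_nonneg integral_nonneg_AE AE_I2) (simp add: power_mult)
        finally show ?thesis
          using h0[of m] by (simp add: power_divide power_mult_distrib power_mult)
      qed
      also have "\<dots> = norm ((sym_diff (h m) ^^ (2 * n)) ?\<phi> (of_real 0))"
        by (subst sym_diff_power_char) auto
      also have "(sym_diff (h m) ^^ (2 * n)) ?\<phi> (of_real 0) = (sym_diff (h m) ^^ (2 * n)) F (of_real 0)"
        using hs[of m] h0[of m] by (intro sym_diff_power_cong[where \<epsilon> = \<epsilon>]) (auto simp: char[simplified])
      also have "norm \<dots> \<le> (2 * h m) ^ (2 * n) * c"
        using norm_sym_diff_power_le[where F = "\<lambda>j. (deriv ^^ j) F" and j = 0 and n = "2 * n" and s = s and h = "h m" and z = 0 and B = c]
          dF sB[of _ "2 * n"] hs[of m] h0[of m] by (simp add: c_def)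
      finally have "expectation (\<lambda>\<omega>. (sin (h m * X \<omega>) / h m) ^ (2 * n)) \<le> c"
        using h0[of m] by (subst (asm) mult_le_cancel_left_pos) auto
      moreover have "(\<integral>\<^sup>+\<omega>. ennreal ((sin (h m * X \<omega>) / h m) ^ (2 * n)) \<partial>M)
          = ennreal (expectation (\<lambda>\<omega>. (sin (h m * X \<omega>) / h m) ^ (2 * n)))"
        using int h0[of m] by (intro nn_integral_eq_integral AE_I2) (auto simp: power_divide power_mult)
      ultimately show ?thesis by (simp add: ennreal_leI)
    qed
    have lim: "(\<lambda>m. ennreal ((sin (h m * X \<omega>) / h m) ^ (2 * n))) \<longlonglongrightarrow> ennreal (X \<omega> ^ (2 * n))" for \<omega>
    proof -
      have "((\<lambda>t. sin (t * X \<omega>)) has_real_derivative X \<omega>) (at 0)"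
        by (auto intro!: derivative_eq_intros)
      then have "(\<lambda>t. sin (t * X \<omega>) / t) \<midarrow>0\<rightarrow> X \<omega>"
        by (simp add: DERIV_def)
      from filterlim_compose[OF this hat] have "(\<lambda>m. sin (h m * X \<omega>) / h m) \<longlonglongrightarrow> X \<omega>" .
      then show ?thesis by (intro tendsto_ennrealI tendsto_power)
    qed
    have "(\<integral>\<^sup>+\<omega>. ennreal (X \<omega> ^ (2 * n)) \<partial>M) = (\<integral>\<^sup>+\<omega>. liminf (\<lambda>m. ennreal ((sin (h m * X \<omega>) / h m) ^ (2 * n))) \<partial>M)"
      using lim by (intro nn_integral_cong lim_imp_Liminf[symmetric]) auto
    also have "\<dots> \<le> liminf (\<lambda>m. \<integral>\<^sup>+\<omega>. ennreal ((sin (h m * X \<omega>) / h m) ^ (2 * n)) \<partial>M)"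
      by (intro nn_integral_liminf) measurable
    also have "\<dots> \<le> ennreal c"
      using le by (intro Liminf_le) auto
    finally show ?thesis unfolding c_def .
  qed
  with s(2) show ?thesis by blast
qed

text \<open>
  The moment bounds make the expectation of the power series of \<open>cosh (r X)\<close> converge
  geometrically, and \<open>exp (r \<bar>X\<bar>) \<le> 2 cosh (r X)\<close>.
\<close>
lemma integrable_exp_abs:
  assumes X[measurable]: "X \<in> borel_measurable M"
    and F: "F holomorphic_on ball 0 R" and r: "0 < r" "r < R" and \<epsilon>: "0 < \<epsilon>"
    and char: "\<And>x. \<bar>x\<bar> < \<epsilon> \<Longrightarrow> expectation (\<lambda>\<omega>. exp (\<i> * of_real (x * X \<omega>))) = F (of_real x)"
  shows "integrable M (\<lambda>\<omega>. exp (r * \<bar>X \<omega>\<bar>))"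
proof -
  define \<rho> where "\<rho> = (r + R) / 2"
  have \<rho>: "0 < \<rho>" "\<rho> < R" "r < \<rho>" using r by (auto simp: \<rho>_def)
  obtain B where B: "0 \<le> B" "\<And>n. (\<integral>\<^sup>+\<omega>. ennreal (X \<omega> ^ (2 * n)) \<partial>M) \<le> ennreal (fact (2 * n) * B / \<rho> ^ (2 * n))"
    using even_moments_le[OF X F \<rho>(1,2) \<epsilon> char] by auto
  define q where "q = (r / \<rho>)\<^sup>2"
  have q: "0 \<le> q" "q < 1" using r \<rho> by (auto simp: q_def power_less_one_iff)
  have cosh: "(\<lambda>n. (r * X \<omega>) ^ (2 * n) / fact (2 * n)) sums cosh (r * X \<omega>)" for \<omega>
  proof -
    have "(if even n then (r * X \<omega>) ^ n /\<^sub>R fact n else 0) = 0" if "n \<notin> range ((*) 2)" for n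
      using that by (auto elim: evenE)
    then have "(\<lambda>n. (r * X \<omega>) ^ (2 * n) /\<^sub>R fact (2 * n)) sums cosh (r * X \<omega>)"
      using cosh_converges[of "r * X \<omega>"] sums_mono_reindex[of "\<lambda>n. 2 * n" "\<lambda>n. if even n then (r * X \<omega>) ^ n /\<^sub>R fact n else 0"]
      by (simp add: strict_mono_def)
    then show ?thesis by (simp add: divide_inverse mult.commute)
  qed
  have "(\<integral>\<^sup>+\<omega>. ennreal (cosh (r * X \<omega>)) \<partial>M) = (\<integral>\<^sup>+\<omega>. (\<Sum>n. ennreal ((r * X \<omega>) ^ (2 * n) / fact (2 * n))) \<partial>M)"
  proof (intro nn_integral_cong)
    fix \<omega>
    have "0 \<le> (r * X \<omega>) ^ (2 * n) / fact (2 * n)" for n by (simp add: power_mult)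
    then show "ennreal (cosh (r * X \<omega>)) = (\<Sum>n. ennreal ((r * X \<omega>) ^ (2 * n) / fact (2 * n)))"
      using cosh[of \<omega>] by (subst suminf_ennreal2) (simp_all only: sums_iff)
  qed
  also have "\<dots> = (\<Sum>n. \<integral>\<^sup>+\<omega>. ennreal ((r * X \<omega>) ^ (2 * n) / fact (2 * n)) \<partial>M)"
    by (intro nn_integral_suminf) measurable
  also have "\<dots> \<le> (\<Sum>n. ennreal (B * q ^ n))"
  proof (intro suminf_le)
    fix n
    have "(\<integral>\<^sup>+\<omega>. ennreal ((r * X \<omega>) ^ (2 * n) / fact (2 * n)) \<partial>M)
        = (\<integral>\<^sup>+\<omega>. ennreal (r ^ (2 * n) / fact (2 * n)) * ennreal (X \<omega> ^ (2 * n)) \<partial>M)"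
      using r by (intro nn_integral_cong) (simp add: power_mult_distrib power_mult flip: ennreal_mult)
    also have "\<dots> = ennreal (r ^ (2 * n) / fact (2 * n)) * (\<integral>\<^sup>+\<omega>. ennreal (X \<omega> ^ (2 * n)) \<partial>M)"
      by (intro nn_integral_cmult) measurable
    also have "\<dots> \<le> ennreal (r ^ (2 * n) / fact (2 * n)) * ennreal (fact (2 * n) * B / \<rho> ^ (2 * n))"
      by (intro mult_left_mono B) auto
    also have "\<dots> = ennreal (B * q ^ n)"
      using r \<rho> B by (simp add: q_def power_divide flip: ennreal_mult power_mult)
    finally show "(\<integral>\<^sup>+\<omega>. ennreal ((r * X \<omega>) ^ (2 * n) / fact (2 * n)) \<partial>M) \<le> ennreal (B * q ^ n)" .
  qed auto
  also have "\<dots> = ennreal (\<Sum>n. B * q ^ n)"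
    using B q by (intro suminf_ennreal2) (auto intro!: summable_mult summable_geometric)
  finally have fin: "(\<integral>\<^sup>+\<omega>. ennreal (cosh (r * X \<omega>)) \<partial>M) < \<infinity>"
    by (rule order.strict_trans1) simp
  have "integrable M (\<lambda>\<omega>. cosh (r * X \<omega>))"
    using fin by (intro integrableI_bounded) (auto simp: cosh_def)
  then have "integrable M (\<lambda>\<omega>. 2 * cosh (r * X \<omega>))" by simp
  then show ?thesis
  proof (rule Bochner_Integration.integrable_bound)
    show "AE \<omega> in M. norm (exp (r * \<bar>X \<omega>\<bar>)) \<le> norm (2 * cosh (r * X \<omega>))"
    proof (intro AE_I2)
      fix \<omega>
      have "exp (r * \<bar>X \<omega>\<bar>) \<le> exp (r * X \<omega>) + exp (- (r * X \<omega>))" by (simp add: abs_if)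
      also have "\<dots> = 2 * cosh (r * X \<omega>)" by (simp add: cosh_def)
      finally show "norm (exp (r * \<bar>X \<omega>\<bar>)) \<le> norm (2 * cosh (r * X \<omega>))" by simp
    qed
  qed measurable
qed

text \<open>
  The exponential series may be integrated term by term, because \<open>exp (r \<bar>X\<bar>)\<close> dominates all its
  partial sums.
\<close>
lemma complex_char_holomorphic:
  assumes [measurable]: "X \<in> borel_measurable M" and int: "integrable M (\<lambda>\<omega>. exp (r * \<bar>X \<omega>\<bar>))"
  shows "(\<lambda>z. expectation (\<lambda>\<omega>. exp (\<i> * z * of_real (X \<omega>)))) holomorphic_on ball 0 r"
proof (rule power_series_holomorphic[where a = "\<lambda>n. expectation (\<lambda>\<omega>. (\<i> * of_real (X \<omega>)) ^ n / fact n)"])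
  fix z :: complex assume "z \<in> ball 0 r"
  then have z: "norm z < r" by simp
  define f where "f n \<omega> = (\<i> * z * of_real (X \<omega>)) ^ n / fact n" for n \<omega>
  have fm[measurable]: "f n \<in> borel_measurable M" for n unfolding f_def by measurable
  have nf: "norm (f n \<omega>) = (norm z * \<bar>X \<omega>\<bar>) ^ n / fact n" for n \<omega>
    by (simp add: f_def norm_divide norm_power norm_mult)
  have es: "(\<lambda>n. norm (f n \<omega>)) sums exp (norm z * \<bar>X \<omega>\<bar>)" for \<omega>
    using exp_converges[of "norm z * \<bar>X \<omega>\<bar>"] by (simp add: nf divide_inverse mult.commute)
  have part: "(\<Sum>i<n. norm (f i \<omega>)) \<le> exp (r * \<bar>X \<omega>\<bar>)" for n \<omega>
  proof -
    have "(\<Sum>i<n. norm (f i \<omega>)) \<le> exp (norm z * \<bar>X \<omega>\<bar>)"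
      using es[of \<omega>] sum_le_suminf[of "\<lambda>n. norm (f n \<omega>)" "{..<n}"] by (simp add: sums_iff)
    also have "\<dots> \<le> exp (r * \<bar>X \<omega>\<bar>)" using z by (simp add: mult_right_mono)
    finally show ?thesis .
  qed
  have fi: "integrable M (f n)" for n
  proof (rule Bochner_Integration.integrable_bound[OF int])
    show "AE \<omega> in M. norm (f n \<omega>) \<le> norm (exp (r * \<bar>X \<omega>\<bar>))"
    proof (intro AE_I2)
      fix \<omega>
      have "norm (f n \<omega>) \<le> (\<Sum>i<Suc n. norm (f i \<omega>))"
        by (intro member_le_sum) auto
      also have "\<dots> \<le> exp (r * \<bar>X \<omega>\<bar>)" by (rule part)
      finally show "norm (f n \<omega>) \<le> norm (exp (r * \<bar>X \<omega>\<bar>))" by simp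
    qed
  qed measurable
  have "(\<lambda>n. expectation (f n)) sums expectation (\<lambda>\<omega>. \<Sum>n. f n \<omega>)"
  proof (rule sums_integral)
    show "AE \<omega> in M. summable (\<lambda>n. norm (f n \<omega>))" using es by (auto simp: sums_iff)
    show "summable (\<lambda>n. expectation (\<lambda>\<omega>. norm (f n \<omega>)))"
    proof (rule summableI_nonneg_bounded)
      fix n
      have "(\<Sum>i<n. expectation (\<lambda>\<omega>. norm (f i \<omega>))) = expectation (\<lambda>\<omega>. \<Sum>i<n. norm (f i \<omega>))"
        using fi by (intro Bochner_Integration.integral_sum[symmetric]) auto
      also have "\<dots> \<le> expectation (\<lambda>\<omega>. exp (r * \<bar>X \<omega>\<bar>))"
        using fi int part by (intro integral_mono) auto
      finally show "(\<Sum>i<n. expectation (\<lambda>\<omega>. norm (f i \<omega>))) \<le> expectation (\<lambda>\<omega>. exp (r * \<bar>X \<omega>\<bar>))" .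
    qed auto
  qed (rule fi)
  also have "(\<lambda>\<omega>. \<Sum>n. f n \<omega>) = (\<lambda>\<omega>. exp (\<i> * z * of_real (X \<omega>)))"
    using exp_converges[of "\<i> * z * of_real (X \<omega>)" for \<omega>]
    by (auto simp: f_def sums_iff scaleR_conv_of_real divide_inverse mult.commute)
  also have "(\<lambda>n. expectation (f n)) = (\<lambda>n. expectation (\<lambda>\<omega>. (\<i> * of_real (X \<omega>)) ^ n / fact n) * (z - 0) ^ n)"
  proof
    fix n
    have "expectation (f n) = expectation (\<lambda>\<omega>. (\<i> * of_real (X \<omega>)) ^ n / fact n * z ^ n)"
      by (intro Bochner_Integration.integral_cong) (auto simp: f_def power_mult_distrib)
    then show "expectation (f n) = expectation (\<lambda>\<omega>. (\<i> * of_real (X \<omega>)) ^ n / fact n) * (z - 0) ^ n" by simp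
  qed
  finally show "(\<lambda>n. expectation (\<lambda>\<omega>. (\<i> * of_real (X \<omega>)) ^ n / fact n) * (z - 0) ^ n) sums
      expectation (\<lambda>\<omega>. exp (\<i> * z * of_real (X \<omega>)))" .
qed

text \<open>
  By the exponential moments the characteristic function is itself holomorphic in the disc, so the
  identity theorem applies to it and \<open>F\<close>.
\<close>
theorem char_eq_holomorphic_extension:
  assumes X[measurable]: "X \<in> borel_measurable M"
    and F: "F holomorphic_on ball 0 R" and \<epsilon>: "0 < \<epsilon>"
    and char: "\<And>x. \<bar>x\<bar> < \<epsilon> \<Longrightarrow> expectation (\<lambda>\<omega>. exp (\<i> * of_real (x * X \<omega>))) = F (of_real x)"
    and x: "\<bar>x\<bar> < R"
  shows "expectation (\<lambda>\<omega>. exp (\<i> * of_real (x * X \<omega>))) = F (of_real x)"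
proof -
  define r where "r = (\<bar>x\<bar> + R) / 2"
  have r: "0 < r" "r < R" "\<bar>x\<bar> < r" using x by (auto simp: r_def)
  define G where "G z = expectation (\<lambda>\<omega>. exp (\<i> * z * of_real (X \<omega>)))" for z
  define d where "d = min \<epsilon> r"
  have d: "0 < d" "d \<le> \<epsilon>" "d \<le> r" using \<epsilon> r by (auto simp: d_def)
  have G: "G holomorphic_on ball 0 r"
    unfolding G_def by (intro complex_char_holomorphic integrable_exp_abs[OF X F r(1,2) \<epsilon> char]) measurable
  have "G (of_real x) - F (of_real x) = 0"
  proof (rule analytic_continuation[where f = "\<lambda>z. G z - F z" and S = "ball 0 r" and U = "of_real ` {0<..<d}" and \<xi> = 0])
    show "(\<lambda>z. G z - F z) holomorphic_on ball 0 r"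
      using r by (intro holomorphic_on_diff G holomorphic_on_subset[OF F]) auto
    show "(0::complex) islimpt of_real ` {0<..<d}"
      unfolding islimpt_approachable
    proof (intro allI impI)
      fix e :: real assume "0 < e"
      then show "\<exists>x'\<in>complex_of_real ` {0<..<d}. x' \<noteq> 0 \<and> dist x' 0 < e"
        using d by (intro bexI[of _ "of_real (min e d / 2)"] conjI imageI) auto
    qed
    show "G z - F z = 0" if "z \<in> of_real ` {0<..<d}" for z
      using that d char by (auto simp: G_def mult.assoc)
  qed (use r d in auto)
  then show ?thesis by (simp add: G_def mult.assoc)
qed

end

section \<open>Continuous branches of the logarithm\<close>

text \<open>
  The difference of two continuous logarithms of the same path takes values in the discrete set
  \<open>2 \<pi> \<i> \<int>\<close>, so it is constant.
\<close>
lemma exp_lifts_agree: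
  fixes h1 h2 :: "real \<Rightarrow> complex"
  assumes "continuous_on {0..1} h1" "continuous_on {0..1} h2"
    and eq: "\<And>x. x \<in> {0..1} \<Longrightarrow> exp (h1 x) = exp (h2 x)" and "h1 0 = h2 0"
  shows "h1 1 = h2 1"
proof -
  define f where "f x = h1 x - h2 x" for x
  have f1: "exp (f x) = 1" if "x \<in> {0..1}" for x
    using eq[OF that] by (simp add: f_def exp_diff)
  have "f constant_on {0..1}"
  proof (rule continuous_discrete_range_constant)
    show "continuous_on {0..1} f" unfolding f_def[abs_def] using assms by (intro continuous_on_diff)
    fix x :: real assume x: "x \<in> {0..1}"
    have "2 * pi \<le> norm (f y - f x)" if y: "y \<in> {0..1}" "f y \<noteq> f x" for y
    proof -
      have "exp (f y - f x) = 1" using f1[OF x] f1[OF y(1)] by (simp add: exp_diff)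
      then obtain n :: int where n: "Re (f y - f x) = 0" "Im (f y - f x) = of_int (2 * n) * pi"
        by (auto simp: exp_eq_1)
      have "n \<noteq> 0" using n y(2) by (auto simp: complex_eq_iff)
      then have "1 \<le> \<bar>real_of_int n\<bar>" by linarith
      then have "2 * pi * 1 \<le> 2 * pi * \<bar>real_of_int n\<bar>" by (intro mult_left_mono) auto
      also have "\<dots> = \<bar>Im (f y - f x)\<bar>" using n(2) by (simp add: abs_mult)
      also have "\<dots> \<le> norm (f y - f x)" by (rule abs_Im_le_cmod)
      finally show ?thesis by simp
    qed
    then show "\<exists>e>0. \<forall>y. y \<in> {0..1} \<and> f y \<noteq> f x \<longrightarrow> e \<le> norm (f y - f x)"
      by (intro exI[of _ "2 * pi"]) auto
  qed auto
  then have "f 1 = f 0" by (auto simp: constant_on_def)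
  then show ?thesis using assms(4) by (simp add: f_def)
qed

text \<open>
  A nowhere vanishing function on a convex set has a continuous logarithm, and each of its branches
  is determined along rays by unique lifting. So a logarithm that is known only on each ray, with no
  continuity from one ray to another, already gives the values of the branch.
\<close>
lemma log_on_eq_radial_lift:
  fixes f :: "real \<times> real \<Rightarrow> complex" and G :: "real \<times> real \<Rightarrow> real \<Rightarrow> complex"
  assumes U: "convex U" "(0, 0) \<in> U" and f: "continuous_on U f"
    and G: "\<And>z. z \<in> U \<Longrightarrow> continuous_on {0..1} (G z)" "\<And>z. z \<in> U \<Longrightarrow> G z 0 = 0"
    and fG: "\<And>z l. z \<in> U \<Longrightarrow> l \<in> {0..1} \<Longrightarrow> f (l *\<^sub>R z) = exp (G z l)"
  shows "log_well_defined_on U f" and "\<And>z. z \<in> U \<Longrightarrow> log_on U f z = G z 1"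
proof -
  have inU: "l *\<^sub>R z \<in> U" if "z \<in> U" "l \<in> {0..1}" for z l
  proof -
    have "(1 - l) *\<^sub>R (0, 0) + l *\<^sub>R z \<in> U"
      using that(2) by (intro convexD_alt[OF U that(1)]) auto
    then show ?thesis by (cases z) (simp only: scaleR_Pair add_Pair mult_zero_right real_scaleR_def add_0_left)
  qed
  have branch: "L z = G z 1" if L: "log_branch_on U f L" and z: "z \<in> U" for L z
  proof -
    have "(\<lambda>l. L (l *\<^sub>R z)) 1 = G z 1"
    proof (rule exp_lifts_agree[where ?h1.0 = "\<lambda>l. L (l *\<^sub>R z)"])
      show "continuous_on {0..1} (\<lambda>l. L (l *\<^sub>R z))"
      proof (rule continuous_on_compose2[where t = U and g = L and f = "\<lambda>l. l *\<^sub>R z"])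
        show "continuous_on U L" using L by (simp add: log_branch_on_def)
        show "continuous_on {0..1} (\<lambda>l. l *\<^sub>R z)" by (intro continuous_intros)
        show "(\<lambda>l. l *\<^sub>R z) ` {0..1} \<subseteq> U" using inU[OF z] by blast
      qed
      show "exp (L (l *\<^sub>R z)) = exp (G z l)" if "l \<in> {0..1}" for l
        using L inU[OF z that] fG[OF z that] unfolding log_branch_on_def by auto
      show "L (0 *\<^sub>R z) = G z 0"
        using L G(2)[OF z] by (simp add: log_branch_on_def zero_prod_def)
    qed (rule G(1)[OF z])
    then show ?thesis by simp
  qed
  have "f z \<noteq> 0" if "z \<in> U" for z using fG[OF that, of 1] by simp
  then obtain g where g: "continuous_on U g" "\<And>z. z \<in> U \<Longrightarrow> f z = exp (g z)"
    using continuous_logarithm_on_contractible[OF f convex_imp_contractible[OF U(1)]] by metis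
  have "f (0, 0) = 1" using fG[OF U(2), of 0] G(2)[OF U(2)] by (simp add: zero_prod_def)
  then have g0: "exp (g (0, 0)) = 1" using g(2)[OF U(2)] by simp
  define L0 where "L0 z = g z - g (0, 0)" for z
  have L0: "log_branch_on U f L0"
    unfolding log_branch_on_def L0_def using g g0 by (auto intro!: continuous_intros simp: exp_diff)
  show "log_well_defined_on U f"
    unfolding log_well_defined_on_def
  proof (intro conjI allI impI ballI)
    show "\<exists>L. log_branch_on U f L" using L0 by blast
    show "L z = L' z" if "log_branch_on U f L \<and> log_branch_on U f L'" "z \<in> U" for L L' z
      using branch[of L z] branch[of L' z] that by simp
  qed
  show "log_on U f z = G z 1" if "z \<in> U" for z
    unfolding log_on_def
  proof (rule the_equality)
    show "\<exists>L. log_branch_on U f L \<and> L z = G z 1" using L0 branch[OF L0 that] by blast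
    show "w = G z 1" if "\<exists>L. log_branch_on U f L \<and> L z = w" for w
      using that branch[OF _ \<open>z \<in> U\<close>] by blast
  qed
qed

lemma (in prob_space) continuous_on_joint_char:
  assumes [measurable]: "X \<in> borel_measurable M" "Y \<in> borel_measurable M"
  shows "continuous_on S (\<lambda>(z1, z2). expectation (\<lambda>\<omega>. exp (\<i> * of_real (z1 * X \<omega> + z2 * Y \<omega>))))"
proof (rule continuous_on_sequentiallyI)
  fix u :: "nat \<Rightarrow> real \<times> real" and a assume u: "u \<longlonglongrightarrow> a"
  have "(\<lambda>n. expectation (\<lambda>\<omega>. exp (\<i> * of_real (fst (u n) * X \<omega> + snd (u n) * Y \<omega>))))
      \<longlonglongrightarrow> expectation (\<lambda>\<omega>. exp (\<i> * of_real (fst a * X \<omega> + snd a * Y \<omega>)))"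
  proof (rule integral_dominated_convergence[where w = "\<lambda>_. 1"])
    show "AE \<omega> in M. (\<lambda>n. exp (\<i> * of_real (fst (u n) * X \<omega> + snd (u n) * Y \<omega>)))
        \<longlonglongrightarrow> exp (\<i> * of_real (fst a * X \<omega> + snd a * Y \<omega>))"
      by (intro AE_I2 tendsto_intros tendsto_fst[OF u] tendsto_snd[OF u])
  qed auto
  then show "(\<lambda>n. case u n of (z1, z2) \<Rightarrow> expectation (\<lambda>\<omega>. exp (\<i> * of_real (z1 * X \<omega> + z2 * Y \<omega>))))
      \<longlonglongrightarrow> (case a of (z1, z2) \<Rightarrow> expectation (\<lambda>\<omega>. exp (\<i> * of_real (z1 * X \<omega> + z2 * Y \<omega>))))"
    by (simp add: case_prod_beta)
qed

section \<open>The cumulant series\<close>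

definition quarter_sum :: real where
  "quarter_sum = (\<Sum>k. real (k + 3) * (1 / 4) ^ k)"

lemma summable_quarter: "summable (\<lambda>k. real (k + 3) * (1 / 4) ^ k)"
proof -
  have "summable (\<lambda>k. real (Suc k) * (1 / 4 :: real) ^ k)"
    using geometric_deriv_sums[of "1 / 4 :: real"] by (simp add: sums_iff)
  moreover have "summable (\<lambda>k. 2 * (1 / 4 :: real) ^ k)"
    by (intro summable_mult summable_geometric) auto
  ultimately have "summable (\<lambda>k. real (Suc k) * (1 / 4 :: real) ^ k + 2 * (1 / 4) ^ k)"
    by (rule summable_add)
  then show ?thesis by (simp add: algebra_simps)
qed

lemma quarter_sum_pos: "0 < quarter_sum"
  unfolding quarter_sum_def by (intro suminf_pos summable_quarter) auto

text \<open>
  The exponents \<open>u^2\<close> and \<open>u^3\<close> are the point: since \<open>u\<close> will be proportional to the size of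
  \<open>(z1, z2)\<close>, everything after the term \<open>a 2\<close> is of higher order than that term.
\<close>
lemma linear_geometric_tail:
  fixes a :: "nat \<Rightarrow> complex"
  assumes a: "\<And>k. 2 \<le> k \<Longrightarrow> norm (a k) \<le> real k * u ^ k * d" and u: "0 \<le> u" "u \<le> 1 / 4" and d: "0 \<le> d"
  shows "norm (\<Sum>k. a (k + 2)) \<le> quarter_sum * u\<^sup>2 * d"
    and "norm ((\<Sum>k. a (k + 2)) - a 2) \<le> quarter_sum * u ^ 3 * d"
proof -
  have le: "norm (a (k + m)) \<le> u ^ m * d * (real (k + 3) * (1 / 4) ^ k)" if "2 \<le> m" "m \<le> 3" for k m
  proof -
    have "norm (a (k + m)) \<le> real (k + m) * u ^ (k + m) * d" using that by (intro a) auto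
    also have "\<dots> = u ^ m * d * (real (k + m) * u ^ k)" by (simp add: power_add)
    also have "\<dots> \<le> u ^ m * d * (real (k + 3) * (1 / 4) ^ k)"
      using u d that by (intro mult_left_mono mult_mono power_mono) auto
    finally show ?thesis .
  qed
  have norm_sum: "norm (\<Sum>k. a (k + m)) \<le> quarter_sum * u ^ m * d" and sm: "summable (\<lambda>k. a (k + m))"
    if "2 \<le> m" "m \<le> 3" for m
  proof -
    have s: "summable (\<lambda>k. u ^ m * d * (real (k + 3) * (1 / 4) ^ k))"
      by (intro summable_mult summable_quarter)
    show "summable (\<lambda>k. a (k + m))"
      by (rule summable_comparison_test'[OF s]) (use le[OF that] in auto)
    have "norm (\<Sum>k. a (k + m)) \<le> (\<Sum>k. u ^ m * d * (real (k + 3) * (1 / 4) ^ k))"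
      by (rule norm_suminf_le[OF _ s]) (use le[OF that] in auto)
    also have "\<dots> = u ^ m * d * quarter_sum"
      unfolding quarter_sum_def by (intro suminf_mult summable_quarter)
    finally show "norm (\<Sum>k. a (k + m)) \<le> quarter_sum * u ^ m * d" by (simp add: mult_ac)
  qed
  show "norm (\<Sum>k. a (k + 2)) \<le> quarter_sum * u\<^sup>2 * d" by (rule norm_sum) auto
  have "(\<Sum>k. a (k + 2)) - a 2 = (\<Sum>k. a (k + 3))"
    using suminf_split_head[OF sm[of 2]] by (simp add: numeral_3_eq_3 numeral_2_eq_2)
  then show "norm ((\<Sum>k. a (k + 2)) - a 2) \<le> quarter_sum * u ^ 3 * d"
    using norm_sum[of 3] by simp
qed

context hurst
begin

definition cumulant_term :: "nat \<Rightarrow> real \<Rightarrow> complex" where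
  "cumulant_term k r = (2 * \<i> * of_real (rosenblatt_sigma H)) ^ k / of_nat k * of_real r"

lemma sigma_pos: "0 < rosenblatt_sigma H"
  using H_gt by (simp add: rosenblatt_sigma_def)

lemma sigma_le_1: "rosenblatt_sigma H \<le> 1"
proof -
  have "H * (2 * H - 1) \<le> 1 * 1" using H_gt H_lt by (intro mult_mono) auto
  then show ?thesis by (simp add: rosenblatt_sigma_def)
qed

lemma norm_cumulant_term_le:
  "norm (cumulant_term k r) \<le> 2 ^ k / real k * \<bar>r\<bar>"
proof -
  have "norm (cumulant_term k r) = (2 * rosenblatt_sigma H) ^ k / real k * \<bar>r\<bar>"
    using sigma_pos by (simp add: cumulant_term_def norm_mult norm_divide norm_power)
  also have "\<dots> \<le> 2 ^ k / real k * \<bar>r\<bar>"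
    using sigma_pos sigma_le_1 by (intro mult_right_mono divide_right_mono power_mono) auto
  finally show ?thesis .
qed

lemma cumulant_term_diff: "cumulant_term k (r - r') = cumulant_term k r - cumulant_term k r'"
  by (simp only: cumulant_term_def of_real_diff right_diff_distrib)

definition cumulant_series :: "(real \<Rightarrow> real) \<Rightarrow> complex \<Rightarrow> complex" where
  "cumulant_series f l = 1 / 2 * (\<Sum>k. cumulant_term (k + 2) (cycle_integral H (k + 2) f) * l ^ (k + 2))"

text \<open>
  The smallness condition makes the coefficients decay like \<open>2^(-k)\<close>. The radius of convergence is then
  at least \<open>2\<close>, which leaves room to evaluate the series at \<open>l = 1\<close> inside an open disc.
\<close>
lemma norm_cumulant_coeff_le:
  assumes W: "W \<in> sets borel" "emeasure lborel W \<le> ennreal w" "0 \<le> w"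
    and f: "\<And>x. \<bar>f x\<bar> \<le> c * indicator W x" "f \<in> borel_measurable borel" and c: "0 \<le> c"
    and small: "4 * (c * path_const w) \<le> 1"
  shows "norm (cumulant_term (k + 2) (cycle_integral H (k + 2) f)) \<le> (1 / 2) ^ k"
proof -
  define q where "q = c * path_const w"
  have q: "0 \<le> q" "2 * q \<le> 1 / 2" using c small path_const_pos[OF W(3)] by (auto simp: q_def)
  have "norm (cumulant_term (k + 2) (cycle_integral H (k + 2) f)) \<le> 2 ^ (k + 2) / real (k + 2) * \<bar>cycle_integral H (k + 2) f\<bar>"
    by (rule norm_cumulant_term_le)
  also have "\<dots> \<le> 2 ^ (k + 2) / real (k + 2) * (2 * q ^ (k + 2))"
    unfolding q_def by (intro mult_left_mono abs_cycle_integral_le[OF _ W f c]) auto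
  also have "\<dots> = 2 / real (k + 2) * (2 * q) ^ (k + 2)"
    by (simp add: power_mult_distrib)
  also have "\<dots> \<le> 1 * (1 / 2) ^ (k + 2)"
    using q by (intro mult_mono power_mono) auto
  also have "\<dots> \<le> (1 / 2) ^ k" by (simp add: power_add)
  finally show ?thesis .
qed

lemma cumulant_series_holomorphic:
  assumes "\<And>k. norm (cumulant_term (k + 2) (cycle_integral H (k + 2) f)) \<le> (1 / 2) ^ k"
  shows "cumulant_series f holomorphic_on ball 0 2"
    and "norm l < 2 \<Longrightarrow> summable (\<lambda>k. cumulant_term (k + 2) (cycle_integral H (k + 2) f) * l ^ (k + 2))"
proof -
  define a where "a k = cumulant_term (k + 2) (cycle_integral H (k + 2) f)" for k
  have sm: "summable (\<lambda>k. a k * l ^ k)" if "norm l < 2" for l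
  proof (rule summable_comparison_test')
    show "summable (\<lambda>k. (norm l / 2) ^ k)" using that by (intro summable_geometric) auto
    fix k
    have "norm (a k * l ^ k) \<le> (1 / 2) ^ k * norm l ^ k"
      unfolding norm_mult norm_power a_def by (intro mult_right_mono assms) auto
    then show "norm (a k * l ^ k) \<le> (norm l / 2) ^ k" by (simp add: power_divide)
  qed
  have sm2: "summable (\<lambda>k. a k * l ^ (k + 2))" if "norm l < 2" for l
  proof -
    have "a k * l ^ (k + 2) = l\<^sup>2 * (a k * l ^ k)" for k by (simp add: power2_eq_square)
    then show ?thesis using summable_mult[OF sm[OF that], of "l\<^sup>2"] by presburger
  qed
  then show "norm l < 2 \<Longrightarrow> summable (\<lambda>k. cumulant_term (k + 2) (cycle_integral H (k + 2) f) * l ^ (k + 2))"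
    by (simp add: a_def)
  have hol: "(\<lambda>l. \<Sum>k. a k * l ^ k) holomorphic_on ball 0 2"
    by (rule power_series_holomorphic[where a = a]) (use sm in \<open>auto intro!: summable_sums\<close>)
  have "cumulant_series f l = 1 / 2 * (l\<^sup>2 * (\<Sum>k. a k * l ^ k))" if "norm l < 2" for l
  proof -
    have "(\<Sum>k. a k * l ^ (k + 2)) = (\<Sum>k. l\<^sup>2 * (a k * l ^ k))"
      by (intro suminf_cong) (simp add: power2_eq_square)
    also have "\<dots> = l\<^sup>2 * (\<Sum>k. a k * l ^ k)" by (rule suminf_mult[OF sm[OF that]])
    finally show ?thesis unfolding cumulant_series_def a_def by simp
  qed
  moreover have "(\<lambda>l. 1 / 2 * (l\<^sup>2 * (\<Sum>k. a k * l ^ k))) holomorphic_on ball 0 2"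
    by (intro holomorphic_intros hol)
  ultimately show "cumulant_series f holomorphic_on ball 0 2"
    by (subst holomorphic_cong[OF refl]) auto
qed

end

section \<open>Decay of the joint logarithm\<close>

definition two_block :: "real \<Rightarrow> real \<Rightarrow> real \<Rightarrow> real \<times> real \<Rightarrow> real \<Rightarrow> real" where
  "two_block s t \<tau> z x = fst z * indicator {s<..t} x + snd z * indicator {s + \<tau><..t + \<tau>} x"

locale rosenblatt = hurst H for H +
  fixes M :: "'a measure" and \<xi> :: "real \<Rightarrow> 'a \<Rightarrow> real"
  assumes rosenblatt: "rosenblatt_process H M \<xi>"
begin

sublocale prob_space M
  using rosenblatt by (simp add: rosenblatt_process_def)

lemma measurable_\<xi>: "0 \<le> t \<Longrightarrow> \<xi> t \<in> borel_measurable M"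
  using rosenblatt by (simp add: rosenblatt_process_def)

text \<open>
  The blocks \<open>(s, t]\<close> and \<open>(s + \<tau>, t + \<tau>]\<close> may overlap; their union has measure at most \<open>2 (t - s)\<close>,
  and if both weights are below \<open>radius\<close> the step function is below \<open>2 radius\<close> there. The constant \<open>8\<close> is
  what \<open>norm_cumulant_coeff_le\<close> then asks for.
\<close>
definition radius :: "real \<Rightarrow> real \<Rightarrow> real" where
  "radius s t = 1 / (8 * path_const (2 * (t - s)))"

definition log_box :: "real \<Rightarrow> real \<Rightarrow> (real \<times> real) set" where
  "log_box s t = {- radius s t<..<radius s t} \<times> {- radius s t<..<radius s t}"

context
  fixes s t :: real
  assumes st: "0 \<le> s" "s < t"
begin

lemma radius_pos: "0 < radius s t"
  using path_const_pos[of "2 * (t - s)"] st by (simp add: radius_def)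

lemma log_box_convex: "convex (log_box s t)"
  unfolding log_box_def by (intro convex_Times convex_real_interval)

lemma log_box_0: "(0, 0) \<in> log_box s t"
  using radius_pos by (simp add: log_box_def)

lemma log_box_interior: "(0, 0) \<in> interior (log_box s t)"
  using log_box_0 unfolding log_box_def by (subst interior_open) (auto intro: open_Times)

lemma log_box_coordinate_axes:
  assumes "z \<in> log_box s t"
  shows "(fst z, 0) \<in> log_box s t" "(0, snd z) \<in> log_box s t"
  using assms radius_pos by (auto simp: log_box_def)

lemma two_block_coeff_le:
  assumes z: "z \<in> log_box s t"
  shows "norm (cumulant_term (k + 2) (cycle_integral H (k + 2) (two_block s t \<tau> z))) \<le> (1 / 2) ^ k"
proof -
  define W where "W = {s<..t} \<union> {s + \<tau><..t + \<tau>}"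
  have "emeasure lborel W \<le> emeasure lborel {s<..t} + emeasure lborel {s + \<tau><..t + \<tau>}"
    unfolding W_def by (intro emeasure_subadditive) auto
  also have "\<dots> = ennreal (2 * (t - s))"
    using st by (simp flip: ennreal_plus)
  finally have W: "emeasure lborel W \<le> ennreal (2 * (t - s))" .
  have zr: "\<bar>fst z\<bar> < radius s t" "\<bar>snd z\<bar> < radius s t" using z by (auto simp: log_box_def)
  show ?thesis
  proof (rule norm_cumulant_coeff_le[where W = W and w = "2 * (t - s)" and c = "2 * radius s t"])
    show "\<bar>two_block s t \<tau> z x\<bar> \<le> 2 * radius s t * indicator W x" for x
      using zr by (auto simp: two_block_def W_def indicator_def)
    show "4 * (2 * radius s t * path_const (2 * (t - s))) \<le> 1"
      using path_const_pos[of "2 * (t - s)"] st by (simp add: radius_def)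
    show "two_block s t \<tau> z \<in> borel_measurable borel" unfolding two_block_def[abs_def] by measurable
  qed (use W st radius_pos in \<open>auto simp: W_def\<close>)
qed

text \<open>
  The finite-dimensional law at the four times \<open>t, s, t + \<tau>, s + \<tau>\<close> with weights
  \<open>x z1, - x z1, x z2, - x z2\<close> gives the formula for small real \<open>x\<close>. The series is holomorphic in the
  disc of radius \<open>2\<close> for each point of \<open>log_box\<close>, so the formula extends to \<open>\<bar>l\<bar> < 2\<close> whatever \<open>\<tau>\<close> is.
\<close>
lemma joint_char_eq:
  assumes \<tau>: "0 < \<tau>" and z: "z \<in> log_box s t" and l: "\<bar>l\<bar> < 2"
  shows "cf_joint M \<xi> s t \<tau> (l *\<^sub>R z) = exp (cumulant_series (two_block s t \<tau> z) (of_real l))"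
proof -
  define X where "X \<omega> = fst z * (\<xi> t \<omega> - \<xi> s \<omega>) + snd z * (\<xi> (t + \<tau>) \<omega> - \<xi> (s + \<tau>) \<omega>)" for \<omega>
  have Xm: "X \<in> borel_measurable M"
    unfolding X_def[abs_def] using st \<tau>
    by (intro borel_measurable_add borel_measurable_times borel_measurable_diff measurable_\<xi>) auto
  have cf: "cf_joint M \<xi> s t \<tau> (x *\<^sub>R z) = expectation (\<lambda>\<omega>. exp (\<i> * of_real (x * X \<omega>)))" for x
    unfolding cf_joint_def X_def by (cases z) (simp add: algebra_simps)
  define T where "T j = (if j = 0 then t else if j = 1 then s else if j = 2 then t + \<tau> else s + \<tau>)" for j :: nat
  define \<theta> where "\<theta> x j = (if j = 0 then x * fst z else if j = 1 then - (x * fst z)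
      else if j = 2 then x * snd z else - (x * snd z))" for x and j :: nat
  have sum4: "(\<Sum>j<4. g j) = g 0 + g 1 + g 2 + g 3" for g :: "nat \<Rightarrow> real"
  proof -
    have "{..<4::nat} = {0, 1, 2, 3}" by auto
    then show ?thesis by simp
  qed
  have step: "step_fun 4 (\<theta> x) T = (\<lambda>y. x * two_block s t \<tau> z y)" for x
  proof
    fix y :: real
    have ind: "indicator {a<..b} y = indicator {0..b} y - (indicator {0..a} y :: real)" if "0 \<le> a" "a < b" for a b
      using that by (auto simp: indicator_def)
    have "step_fun 4 (\<theta> x) T y = x * fst z * (indicator {0..t} y - indicator {0..s} y)
        + x * snd z * (indicator {0..t + \<tau>} y - indicator {0..s + \<tau>} y)"
      unfolding step_fun_def sum4 by (simp add: \<theta>_def T_def right_diff_distrib)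
    also have "\<dots> = x * two_block s t \<tau> z y"
      unfolding two_block_def using st \<tau> by (simp add: ind[of s t] ind[of "s + \<tau>" "t + \<tau>"] distrib_left mult.assoc)
    finally show "step_fun 4 (\<theta> x) T y = x * two_block s t \<tau> z y" .
  qed
  have lin: "(\<Sum>j<4. \<theta> x j * \<xi> (T j) \<omega>) = x * X \<omega>" for x \<omega>
    unfolding sum4 by (simp add: \<theta>_def T_def X_def algebra_simps)
  have trm: "rosenblatt_term H 4 (\<theta> x) T k =
      cumulant_term k (cycle_integral H k (two_block s t \<tau> z)) * of_real x ^ k" for x k
    by (simp add: rosenblatt_term_def cumulant_term_def rosenblatt_R_eq_cycle_integral step cycle_integral_scale)
  have T0: "\<forall>j<4. 0 \<le> T j" using st \<tau> by (auto simp: T_def)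
  have "(\<forall>j<4. 0 \<le> T j) \<longrightarrow>
      (\<exists>\<epsilon>>0. \<forall>\<theta>. (\<forall>j<4. \<bar>\<theta> j\<bar> < \<epsilon>) \<longrightarrow>
         summable (\<lambda>k. rosenblatt_term H 4 \<theta> T (k + 2)) \<and>
         expectation (\<lambda>\<omega>. exp (\<i> * of_real (\<Sum>j<4. \<theta> j * \<xi> (T j) \<omega>)))
           = exp (1 / 2 * (\<Sum>k. rosenblatt_term H 4 \<theta> T (k + 2))))"
    using rosenblatt unfolding rosenblatt_process_def
    by (elim conjE) (drule spec[of _ "4 :: nat"], drule spec[of _ T], assumption)
  from mp[OF this T0] obtain \<epsilon> where \<epsilon>: "0 < \<epsilon>" "\<And>\<theta>. (\<And>j. j < 4 \<Longrightarrow> \<bar>\<theta> j\<bar> < \<epsilon>) \<Longrightarrow>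
      expectation (\<lambda>\<omega>. exp (\<i> * of_real (\<Sum>j<4. \<theta> j * \<xi> (T j) \<omega>)))
        = exp (1 / 2 * (\<Sum>k. rosenblatt_term H 4 \<theta> T (k + 2)))"
    by auto
  define e where "e = \<epsilon> / (1 + \<bar>fst z\<bar> + \<bar>snd z\<bar>)"
  have e: "0 < e" using \<epsilon>(1) by (simp add: e_def add_pos_nonneg)
  have loc: "expectation (\<lambda>\<omega>. exp (\<i> * of_real (x * X \<omega>))) = exp (cumulant_series (two_block s t \<tau> z) (of_real x))"
    if x: "\<bar>x\<bar> < e" for x
  proof -
    have lt: "\<bar>x * u\<bar> < \<epsilon>" if u: "\<bar>u\<bar> \<le> 1 + \<bar>fst z\<bar> + \<bar>snd z\<bar>" for u
    proof -
      have "\<bar>x * u\<bar> \<le> \<bar>x\<bar> * (1 + \<bar>fst z\<bar> + \<bar>snd z\<bar>)" unfolding abs_mult using u by (intro mult_left_mono) auto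
      also have "\<dots> < \<epsilon>" using x unfolding e_def by (simp add: pos_less_divide_eq add_pos_nonneg)
      finally show ?thesis .
    qed
    have "\<bar>\<theta> x j\<bar> < \<epsilon>" for j
      using lt[of "fst z"] lt[of "snd z"] by (auto simp: \<theta>_def)
    from \<epsilon>(2)[of "\<theta> x", OF this] show ?thesis
      unfolding lin trm cumulant_series_def .
  qed
  have hol: "(\<lambda>l. exp (cumulant_series (two_block s t \<tau> z) l)) holomorphic_on ball 0 2"
    by (rule holomorphic_on_exp'[OF cumulant_series_holomorphic(1)[OF two_block_coeff_le[OF z]]])
  show ?thesis
    unfolding cf by (rule char_eq_holomorphic_extension[OF Xm hol e loc l])
qed

lemma radial_lift:
  assumes \<tau>: "0 < \<tau>" and z: "z \<in> log_box s t"
  shows "continuous_on {0..1} (\<lambda>l. cumulant_series (two_block s t \<tau> z) (of_real l))"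
    and "cumulant_series (two_block s t \<tau> z) (of_real 0) = 0"
proof -
  have "continuous_on (ball 0 2) (cumulant_series (two_block s t \<tau> z))"
    by (rule holomorphic_on_imp_continuous_on[OF cumulant_series_holomorphic(1)[OF two_block_coeff_le[OF z]]])
  then show "continuous_on {0..1} (\<lambda>l. cumulant_series (two_block s t \<tau> z) (of_real l))"
    by (rule continuous_on_compose2) (auto intro!: continuous_intros)
  show "cumulant_series (two_block s t \<tau> z) (of_real 0) = 0"
    by (simp add: cumulant_series_def)
qed

text \<open>
  The marginal characteristic functions are the joint one at \<open>(z1, 0)\<close> and \<open>(0, z2)\<close>, and the box
  contains these points along with \<open>(z1, z2)\<close>; so all three logarithms are handled at once.
\<close>
lemma log_on_log_box:
  assumes \<tau>: "0 < \<tau>"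
  shows joint_log: "log_well_defined_on (log_box s t) (cf_joint M \<xi> s t \<tau>)"
      "\<And>z. z \<in> log_box s t \<Longrightarrow> log_on (log_box s t) (cf_joint M \<xi> s t \<tau>) z = cumulant_series (two_block s t \<tau> z) 1"
    and fst_log: "log_well_defined_on (log_box s t) (cf_fst M \<xi> s t)"
      "\<And>z. z \<in> log_box s t \<Longrightarrow> log_on (log_box s t) (cf_fst M \<xi> s t) z = cumulant_series (two_block s t \<tau> (fst z, 0)) 1"
    and snd_log: "log_well_defined_on (log_box s t) (cf_snd M \<xi> s t \<tau>)"
      "\<And>z. z \<in> log_box s t \<Longrightarrow> log_on (log_box s t) (cf_snd M \<xi> s t \<tau>) z = cumulant_series (two_block s t \<tau> (0, snd z)) 1"
proof -
  have cont: "continuous_on S (cf_joint M \<xi> s t \<tau>)" for S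
    unfolding cf_joint_def using st \<tau>
    by (intro continuous_on_joint_char borel_measurable_diff measurable_\<xi>) auto
  have lift: "log_well_defined_on (log_box s t) (\<lambda>z. cf_joint M \<xi> s t \<tau> (P z)) \<and>
      (\<forall>z\<in>log_box s t. log_on (log_box s t) (\<lambda>z. cf_joint M \<xi> s t \<tau> (P z)) z = cumulant_series (two_block s t \<tau> (P z)) 1)"
    if P: "\<And>z. z \<in> log_box s t \<Longrightarrow> P z \<in> log_box s t" "continuous_on (log_box s t) P" "\<And>l z. P (l *\<^sub>R z) = l *\<^sub>R P z" for P
  proof -
    have 1: "continuous_on (log_box s t) (\<lambda>z. cf_joint M \<xi> s t \<tau> (P z))"
      by (rule continuous_on_compose2[OF cont P(2) order_refl])
    note * = log_on_eq_radial_lift[OF log_box_convex log_box_0 1,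
        where G = "\<lambda>z l. cumulant_series (two_block s t \<tau> (P z)) (of_real l)"]
    show ?thesis
      using *(1)[OF radial_lift[OF \<tau> P(1)]] *(2)[OF radial_lift[OF \<tau> P(1)]]
      using joint_char_eq[OF \<tau> P(1)] by (simp add: P(3))
  qed
  have c1: "continuous_on (log_box s t) (\<lambda>z. (fst z, 0 :: real))" and c2: "continuous_on (log_box s t) (\<lambda>z. (0 :: real, snd z))"
    by (intro continuous_intros)+
  have fst: "cf_fst M \<xi> s t = (\<lambda>z. cf_joint M \<xi> s t \<tau> (fst z, 0))"
    and snd: "cf_snd M \<xi> s t \<tau> = (\<lambda>z. cf_joint M \<xi> s t \<tau> (0, snd z))"
    by (auto simp: cf_fst_def cf_snd_def cf_joint_def)
  show "log_well_defined_on (log_box s t) (cf_joint M \<xi> s t \<tau>)"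
      "\<And>z. z \<in> log_box s t \<Longrightarrow> log_on (log_box s t) (cf_joint M \<xi> s t \<tau>) z = cumulant_series (two_block s t \<tau> z) 1"
    using lift[of "\<lambda>z. z"] by simp_all
  show "log_well_defined_on (log_box s t) (cf_fst M \<xi> s t)"
      "\<And>z. z \<in> log_box s t \<Longrightarrow> log_on (log_box s t) (cf_fst M \<xi> s t) z = cumulant_series (two_block s t \<tau> (fst z, 0)) 1"
    unfolding fst using lift[of "\<lambda>z. (fst z, 0)", OF log_box_coordinate_axes(1) c1] by simp_all
  show "log_well_defined_on (log_box s t) (cf_snd M \<xi> s t \<tau>)"
      "\<And>z. z \<in> log_box s t \<Longrightarrow> log_on (log_box s t) (cf_snd M \<xi> s t \<tau>) z = cumulant_series (two_block s t \<tau> (0, snd z)) 1"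
    unfolding snd using lift[of "\<lambda>z. (0, snd z)", OF log_box_coordinate_axes(2) c2] by simp_all
qed

lemma D_well_defined: "0 < \<tau> \<Longrightarrow> D_well_defined_on (log_box s t) M \<xi> s t \<tau>"
  unfolding D_well_defined_on_def using log_on_log_box by blast

definition mixed_term :: "real \<Rightarrow> real \<times> real \<Rightarrow> nat \<Rightarrow> complex" where
  "mixed_term \<tau> z k = cumulant_term k
    (mixed_cycle k (\<lambda>x. fst z * indicator {s<..t} x) (\<lambda>x. snd z * indicator {s + \<tau><..t + \<tau>} x))"

lemma D_xi_eq:
  assumes \<tau>: "0 < \<tau>" and z: "z \<in> log_box s t"
  shows "D_xi (log_box s t) M \<xi> \<tau> z s t = 1 / 2 * norm (\<Sum>k. mixed_term \<tau> z (k + 2))"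
proof -
  note z' = log_box_coordinate_axes[OF z]
  let ?a = "\<lambda>z k. cumulant_term (k + 2) (cycle_integral H (k + 2) (two_block s t \<tau> z))"
  have sm: "summable (?a z)" if "z \<in> log_box s t" for z
    using cumulant_series_holomorphic(2)[OF two_block_coeff_le[OF that], of 1] by simp
  have "D_xi (log_box s t) M \<xi> \<tau> z s t = norm (1 / 2 * ((\<Sum>k. ?a z k) - (\<Sum>k. ?a (fst z, 0) k) - (\<Sum>k. ?a (0, snd z) k)))"
    unfolding D_xi_def joint_log(2)[OF \<tau> z] fst_log(2)[OF \<tau> z] snd_log(2)[OF \<tau> z] cumulant_series_def
    by (simp add: algebra_simps)
  also have "(\<Sum>k. ?a z k) - (\<Sum>k. ?a (fst z, 0) k) - (\<Sum>k. ?a (0, snd z) k) = (\<Sum>k. ?a z k - ?a (fst z, 0) k - ?a (0, snd z) k)"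
    using sm z z' by (simp add: suminf_diff summable_diff)
  also have "(\<lambda>k. ?a z k - ?a (fst z, 0) k - ?a (0, snd z) k) = (\<lambda>k. mixed_term \<tau> z (k + 2))"
    unfolding mixed_term_def mixed_cycle_def cumulant_term_diff two_block_def[abs_def] by simp
  finally show ?thesis by (simp add: norm_mult)
qed

lemma norm_mixed_term_le:
  assumes \<tau>: "t - s < \<tau>" and k: "2 \<le> k" and c: "\<bar>fst z\<bar> \<le> c" "\<bar>snd z\<bar> \<le> c"
  shows "norm (mixed_term \<tau> z k) \<le> real k * (2 * (c * path_const (2 * (t - s)))) ^ k * (\<tau> - (t - s)) powr (2 * H - 2)"
proof -
  define A where "A = {s<..t}"
  define B where "B = {s + \<tau><..t + \<tau>}"
  define m where "m = mixed_cycle k (\<lambda>x. fst z * indicator A x) (\<lambda>x. snd z * indicator B x)"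
  have "emeasure lborel (A \<union> B) \<le> emeasure lborel A + emeasure lborel B"
    unfolding A_def B_def by (intro emeasure_subadditive) auto
  also have "\<dots> = ennreal (2 * (t - s))"
    using st by (simp add: A_def B_def flip: ennreal_plus)
  finally have w: "emeasure lborel (A \<union> B) \<le> ennreal (2 * (t - s))" .
  have "\<bar>m\<bar> \<le> (real k)\<^sup>2 * (c * path_const (2 * (t - s))) ^ k * (\<tau> - (t - s)) powr (2 * H - 2)"
    unfolding m_def
  proof (rule abs_mixed_cycle_le[OF k _ _ _ _ _ w])
    show "A \<inter> B = {}" using \<tau> by (auto simp: A_def B_def)
    show "\<tau> - (t - s) \<le> \<bar>x - y\<bar>" if "x \<in> A" "y \<in> B" for x y using that by (auto simp: A_def B_def)
  qed (use st \<tau> c in \<open>auto simp: A_def B_def indicator_def\<close>)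
  then have "2 ^ k / real k * \<bar>m\<bar> \<le> 2 ^ k / real k * ((real k)\<^sup>2 * (c * path_const (2 * (t - s))) ^ k * (\<tau> - (t - s)) powr (2 * H - 2))"
    by (intro mult_left_mono) auto
  also have "\<dots> = real k * (2 * (c * path_const (2 * (t - s)))) ^ k * (\<tau> - (t - s)) powr (2 * H - 2)"
    using k by (simp add: power_mult_distrib power2_eq_square)
  finally show ?thesis
    using norm_cumulant_term_le[of k m] unfolding mixed_term_def m_def A_def B_def by linarith
qed

lemma D_xi_le:
  assumes \<tau>: "t - s < \<tau>" and z: "z \<in> log_box s t"
  shows "D_xi (log_box s t) M \<xi> \<tau> z s t \<le> quarter_sum * (\<tau> - (t - s)) powr (2 * H - 2)"
proof -
  define u where "u = 2 * (radius s t * path_const (2 * (t - s)))"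
  have u: "u = 1 / 4"
    using path_const_pos[of "2 * (t - s)"] st by (simp add: u_def radius_def)
  have "norm (\<Sum>k. mixed_term \<tau> z (k + 2)) \<le> quarter_sum * u\<^sup>2 * (\<tau> - (t - s)) powr (2 * H - 2)"
    using z \<tau> u unfolding u_def
    by (intro linear_geometric_tail(1) norm_mixed_term_le) (auto simp: log_box_def)
  also have "\<dots> \<le> quarter_sum * 1 * (\<tau> - (t - s)) powr (2 * H - 2)"
    using quarter_sum_pos by (intro mult_right_mono mult_left_mono) (auto simp: u power2_eq_square)
  finally have le: "norm (\<Sum>k. mixed_term \<tau> z (k + 2)) \<le> quarter_sum * (\<tau> - (t - s)) powr (2 * H - 2)" by simp
  have "0 < \<tau>" using \<tau> st by simp
  from D_xi_eq[OF this z] show ?thesis using le norm_ge_zero[of "\<Sum>k. mixed_term \<tau> z (k + 2)"] by linarith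
qed

text \<open>
  On the diagonal point \<open>(v, v)\<close> the term of order \<open>2\<close> contributes at least \<open>4 \<sigma>^2 v^2 (t - s)^2\<close> times
  \<open>(\<tau> + (t - s))^(2H-2)\<close>. The number \<open>v\<close> is chosen such that the tail is at most half of this. For
  \<open>\<tau> \<ge> 3 (t - s)\<close> the distances \<open>\<tau> - (t - s)\<close> and \<open>\<tau> + (t - s)\<close> differ by a factor of at most \<open>2\<close>, which
  makes the two bounds comparable.
\<close>
lemma D_xi_ge:
  obtains z c where "z \<in> log_box s t" "0 < c"
    "\<And>\<tau>. 3 * (t - s) \<le> \<tau> \<Longrightarrow> c * (\<tau> + (t - s)) powr (2 * H - 2) \<le> D_xi (log_box s t) M \<xi> \<tau> z s t"
proof -
  define T where "T = t - s"
  define C where "C = path_const (2 * T)"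
  define \<sigma> where "\<sigma> = rosenblatt_sigma H"
  have T: "0 < T" using st by (simp add: T_def)
  have C: "0 < C" using T by (simp add: C_def path_const_pos)
  define v where "v = min (radius s t / 2) (\<sigma>\<^sup>2 * T\<^sup>2 / (8 * quarter_sum * C ^ 3))"
  have \<sigma>: "0 < \<sigma>" using sigma_pos by (simp add: \<sigma>_def)
  have v: "0 < v" "v < radius s t" and v2: "v \<le> \<sigma>\<^sup>2 * T\<^sup>2 / (8 * quarter_sum * C ^ 3)"
    using radius_pos \<sigma> T C quarter_sum_pos by (auto simp: v_def)
  have v3: "8 * quarter_sum * C ^ 3 * v \<le> \<sigma>\<^sup>2 * T\<^sup>2"
    using v2 C quarter_sum_pos by (simp add: pos_le_divide_eq mult_ac)
  have vz: "(v, v) \<in> log_box s t" using v by (simp add: log_box_def)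
  show ?thesis
  proof (rule that[of "(v, v)" "\<sigma>\<^sup>2 * v\<^sup>2 * T\<^sup>2"])
    fix \<tau> assume \<tau>: "3 * (t - s) \<le> \<tau>"
    define d where "d = (\<tau> - T) powr (2 * H - 2)"
    define n where "n = (\<tau> + T) powr (2 * H - 2)"
    have \<tau>': "T < \<tau>" "0 < \<tau>" using \<tau> T by (auto simp: T_def)
    have n0: "0 \<le> n" by (simp add: n_def)
    have dn: "d \<le> 2 * n"
    proof -
      have "d \<le> ((\<tau> + T) / 2) powr (2 * H - 2)"
        unfolding d_def using \<tau> T H_lt by (intro powr_mono2') (auto simp: T_def)
      also have "\<dots> = (1 / 2) powr (2 * H - 2) * n"
        unfolding n_def using powr_mult[of "1 / 2" "\<tau> + T" "2 * H - 2"] \<tau>' T by simp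
      also have "(1 / 2 :: real) powr (2 * H - 2) \<le> (1 / 2) powr (- 1)"
        using H_gt by (intro powr_mono') auto
      then have "(1 / 2) powr (2 * H - 2) * n \<le> 2 * n"
        using n0 by (intro mult_right_mono) (auto simp: powr_minus)
      finally show ?thesis .
    qed
    define u where "u = 2 * (v * C)"
    have u: "0 \<le> u" "u \<le> 1 / 4"
    proof -
      have "v * C \<le> radius s t * C" using v C by (intro mult_right_mono) auto
      also have "\<dots> = 1 / 8" using C by (simp add: radius_def C_def T_def)
      finally show "u \<le> 1 / 4" by (simp add: u_def)
      show "0 \<le> u" using v C by (simp add: u_def)
    qed
    have "norm ((\<Sum>k. mixed_term \<tau> (v, v) (k + 2)) - mixed_term \<tau> (v, v) 2) \<le> quarter_sum * u ^ 3 * d"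
      using norm_mixed_term_le[of \<tau> _ "(v, v)" v] v \<tau>' unfolding T_def u_def C_def d_def
      by (intro linear_geometric_tail(2)[OF _ u[unfolded u_def C_def T_def]]) auto
    also have "\<dots> \<le> quarter_sum * u ^ 3 * (2 * n)"
      using quarter_sum_pos u dn by (intro mult_left_mono) auto
    also have "\<dots> = 2 * v\<^sup>2 * n * (8 * quarter_sum * C ^ 3 * v)"
      by (simp add: u_def power_mult_distrib power2_eq_square power3_eq_cube)
    also have "\<dots> \<le> 2 * v\<^sup>2 * n * (\<sigma>\<^sup>2 * T\<^sup>2)"
      using v3 n0 by (intro mult_left_mono) auto
    finally have tail: "norm ((\<Sum>k. mixed_term \<tau> (v, v) (k + 2)) - mixed_term \<tau> (v, v) 2) \<le> 2 * v\<^sup>2 * n * (\<sigma>\<^sup>2 * T\<^sup>2)" .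
    have lead: "4 * v\<^sup>2 * n * (\<sigma>\<^sup>2 * T\<^sup>2) \<le> norm (mixed_term \<tau> (v, v) 2)"
    proof -
      define m where "m = mixed_cycle 2 (\<lambda>x. v * indicator {s<..t} x) (\<lambda>x. v * indicator {s + \<tau><..t + \<tau>} x)"
      have m: "2 * v\<^sup>2 * (T * T) * n \<le> m"
        unfolding m_def n_def T_def using v st \<tau>' by (intro mixed_cycle_2_ge) (auto simp: T_def)
      moreover have "0 \<le> 2 * v\<^sup>2 * (T * T) * n" using n0 T by simp
      ultimately have m0: "0 \<le> m" by linarith
      have "norm (mixed_term \<tau> (v, v) 2) = 2 * \<sigma>\<^sup>2 * m"
        using m0 \<sigma> unfolding mixed_term_def m_def[symmetric] fst_conv snd_conv cumulant_term_def \<sigma>_def[symmetric]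
        by (simp add: norm_mult norm_divide norm_power power_mult_distrib)
      moreover have "2 * \<sigma>\<^sup>2 * (2 * v\<^sup>2 * (T * T) * n) \<le> 2 * \<sigma>\<^sup>2 * m"
        using m by (intro mult_left_mono) auto
      ultimately show ?thesis by (simp add: power2_eq_square mult_ac)
    qed
    have "norm (mixed_term \<tau> (v, v) 2) \<le> norm (\<Sum>k. mixed_term \<tau> (v, v) (k + 2))
        + norm ((\<Sum>k. mixed_term \<tau> (v, v) (k + 2)) - mixed_term \<tau> (v, v) 2)"
      using norm_triangle_ineq4[of "\<Sum>k. mixed_term \<tau> (v, v) (k + 2)" "(\<Sum>k. mixed_term \<tau> (v, v) (k + 2)) - mixed_term \<tau> (v, v) 2"] by simp
    then have "2 * (v\<^sup>2 * n * (\<sigma>\<^sup>2 * T\<^sup>2)) \<le> norm (\<Sum>k. mixed_term \<tau> (v, v) (k + 2))"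
      using tail lead by (simp add: mult.assoc)
    then show "\<sigma>\<^sup>2 * v\<^sup>2 * T\<^sup>2 * (\<tau> + (t - s)) powr (2 * H - 2) \<le> D_xi (log_box s t) M \<xi> \<tau> (v, v) s t"
      unfolding D_xi_eq[OF \<tau>'(2) vz] n_def T_def by (simp add: mult_ac)
  qed (use vz \<sigma> v T in auto)
qed

lemma D_xi_bigo:
  assumes z: "z \<in> log_box s t"
  shows "(\<lambda>\<tau>. D_xi (log_box s t) M \<xi> \<tau> z s t) \<in> O[at_top](\<lambda>\<tau>. \<tau> powr (2 * H - 2))"
proof (rule bigoI)
  show "\<forall>\<^sub>F \<tau> in at_top. norm (D_xi (log_box s t) M \<xi> \<tau> z s t)
      \<le> quarter_sum * (1 / 2) powr (2 * H - 2) * norm (\<tau> powr (2 * H - 2))"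
    using eventually_ge_at_top[of "2 * (t - s)"]
  proof eventually_elim
    case (elim \<tau>)
    have \<tau>: "t - s < \<tau>" "0 < \<tau>" using elim st by auto
    have "norm (D_xi (log_box s t) M \<xi> \<tau> z s t) = D_xi (log_box s t) M \<xi> \<tau> z s t"
      by (simp add: D_xi_def)
    also have "\<dots> \<le> quarter_sum * (\<tau> - (t - s)) powr (2 * H - 2)"
      by (rule D_xi_le[OF \<tau>(1) z])
    also have "\<dots> \<le> quarter_sum * (\<tau> / 2) powr (2 * H - 2)"
      using elim \<tau> H_lt quarter_sum_pos by (intro mult_left_mono powr_mono2') auto
    also have "\<dots> = quarter_sum * (1 / 2) powr (2 * H - 2) * norm (\<tau> powr (2 * H - 2))"
      using powr_mult[of "1 / 2" \<tau> "2 * H - 2"] \<tau> by simp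
    finally show ?case .
  qed
qed

text \<open>
  The supremum need not be attained, so every number below \<open>2 - 2H\<close> is exceeded by an admissible
  \<open>\<gamma> < 2 - 2H\<close>; such a \<open>\<gamma>\<close> has to be chosen positive.
\<close>
lemma decay_rates_ge:
  assumes z: "z \<in> log_box s t"
  shows "ereal (2 - 2 * H) \<le> (SUP \<gamma>\<in>{\<gamma>. \<gamma> > 0 \<and> (\<lambda>\<tau>. D_xi (log_box s t) M \<xi> \<tau> z s t) \<in> o[at_top](\<lambda>\<tau>. \<tau> powr (- \<gamma>))}. ereal \<gamma>)"
    (is "_ \<le> (SUP \<gamma>\<in>?S. ereal \<gamma>)")
  unfolding le_SUP_iff
proof (intro allI impI)
  have in_S: "\<gamma> \<in> ?S" if "0 < \<gamma>" "\<gamma> < 2 - 2 * H" for \<gamma>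
  proof -
    have "(\<lambda>\<tau>. \<tau> powr (2 * H - 2)) \<in> o[at_top](\<lambda>\<tau>. \<tau> powr (- \<gamma>) :: real)"
      using that by (subst powr_smallo_iff) (auto simp: filterlim_ident)
    with D_xi_bigo[OF z] show ?thesis
      using that by (auto intro: landau_o.big_small_trans)
  qed
  fix y assume y: "y < ereal (2 - 2 * H)"
  then obtain r where r: "y \<le> ereal r" "r < 2 - 2 * H"
  proof (cases y)
    case (real r)
    then show ?thesis using y that[of r] by simp
  next
    case MInf
    then show ?thesis using H_lt that[of 0] by simp
  qed (use y in auto)
  define \<gamma> where "\<gamma> = (max r 0 + (2 - 2 * H)) / 2"
  have \<gamma>: "0 < \<gamma>" "\<gamma> < 2 - 2 * H" "r < \<gamma>" using r H_lt by (auto simp: \<gamma>_def max_def)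
  then have "y < ereal \<gamma>" using r(1) by (simp add: order.strict_trans1)
  then show "\<exists>\<gamma>\<in>?S. y < ereal \<gamma>" using in_S[OF \<gamma>(1,2)] by blast
qed

text \<open>
  One point of the neighborhood suffices, because the exponent is an infimum over all of them.
\<close>
lemma decay_rates_le:
  "\<exists>z\<in>log_box s t. (SUP \<gamma>\<in>{\<gamma>. \<gamma> > 0 \<and> (\<lambda>\<tau>. D_xi (log_box s t) M \<xi> \<tau> z s t) \<in> o[at_top](\<lambda>\<tau>. \<tau> powr (- \<gamma>))}. ereal \<gamma>)
    \<le> ereal (2 - 2 * H)"
proof -
  obtain z c where z: "z \<in> log_box s t" and c: "0 < c"
    and ge: "\<And>\<tau>. 3 * (t - s) \<le> \<tau> \<Longrightarrow> c * (\<tau> + (t - s)) powr (2 * H - 2) \<le> D_xi (log_box s t) M \<xi> \<tau> z s t"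
    using D_xi_ge by metis
  have big: "(\<lambda>\<tau>. \<tau> powr (2 * H - 2)) \<in> O[at_top](\<lambda>\<tau>. D_xi (log_box s t) M \<xi> \<tau> z s t)"
  proof (rule bigoI)
    show "\<forall>\<^sub>F \<tau> in at_top. norm (\<tau> powr (2 * H - 2)) \<le> 1 / (c * 2 powr (2 * H - 2)) * norm (D_xi (log_box s t) M \<xi> \<tau> z s t)"
      using eventually_ge_at_top[of "3 * (t - s)"]
    proof eventually_elim
      case (elim \<tau>)
      have "c * 2 powr (2 * H - 2) * \<tau> powr (2 * H - 2) = c * (2 * \<tau>) powr (2 * H - 2)"
        using elim st by (simp add: powr_mult)
      also have "\<dots> \<le> c * (\<tau> + (t - s)) powr (2 * H - 2)"
        using elim st c H_lt by (intro mult_left_mono powr_mono2') auto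
      also have "\<dots> \<le> D_xi (log_box s t) M \<xi> \<tau> z s t" by (rule ge[OF elim])
      also have "\<dots> \<le> norm (D_xi (log_box s t) M \<xi> \<tau> z s t)" by simp
      finally show ?case using c by (simp add: field_simps)
    qed
  qed
  have "\<gamma> \<le> 2 - 2 * H" if "(\<lambda>\<tau>. D_xi (log_box s t) M \<xi> \<tau> z s t) \<in> o[at_top](\<lambda>\<tau>. \<tau> powr (- \<gamma>))" for \<gamma>
  proof -
    have "(\<lambda>\<tau>. \<tau> powr (2 * H - 2)) \<in> o[at_top](\<lambda>\<tau>. \<tau> powr (- \<gamma>) :: real)"
      by (rule landau_o.big_small_trans[OF big that])
    then have "2 * H - 2 < - \<gamma>"
      by (subst (asm) powr_smallo_iff) (auto simp: filterlim_ident)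
    then show ?thesis by simp
  qed
  then show ?thesis using z by (intro bexI[of _ z] SUP_least) auto
qed

end

lemma decay_exponent_log_box: "decay_exponent log_box M \<xi> = ereal (2 - 2 * H)"
proof (rule antisym)
  obtain z where z: "z \<in> log_box 0 1"
    "(SUP \<gamma>\<in>{\<gamma>. \<gamma> > 0 \<and> (\<lambda>\<tau>. D_xi (log_box 0 1) M \<xi> \<tau> z 0 1) \<in> o[at_top](\<lambda>\<tau>. \<tau> powr (- \<gamma>))}. ereal \<gamma>)
    \<le> ereal (2 - 2 * H)"
    using decay_rates_le[of 0 1] by auto
  show "decay_exponent log_box M \<xi> \<le> ereal (2 - 2 * H)"
    unfolding decay_exponent_def
    by (rule INF_lower2[of "(0, 1)"]) (auto intro!: INF_lower2[OF z(1)] z(2))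
  show "ereal (2 - 2 * H) \<le> decay_exponent log_box M \<xi>"
    unfolding decay_exponent_def by (auto intro!: INF_greatest decay_rates_ge)
qed

end

theorem theorem4p1:
  fixes H :: real and M :: "'a measure" and \<xi> :: "real \<Rightarrow> 'a \<Rightarrow> real"
  assumes "1 / 2 < H" and "H < 1"
    and "rosenblatt_process H M \<xi>"
  shows "\<exists>U :: real \<Rightarrow> real \<Rightarrow> (real \<times> real) set.
     (\<forall>s t. 0 \<le> s \<and> s < t \<longrightarrow>
        (0, 0) \<in> interior (U s t) \<and> (\<forall>\<tau>>0. D_well_defined_on (U s t) M \<xi> s t \<tau>)) \<and>
     decay_exponent U M \<xi> = ereal (2 - 2 * H)"
proof -
  interpret rosenblatt H M \<xi>
    using assms by unfold_locales
  show ?thesis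
    using log_box_interior D_well_defined decay_exponent_log_box by (intro exI[of _ log_box]) auto
qed

end
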